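(* Let $E$ be a uniformly smooth real Banach space, $D\subseteq E$ a nonempty closed convex subset, $T:D\to D$ a nonexpansive mapping with $F(T)\neq\emptyset$, $f\in\Pi_D$ and $x_0\in D$. Let $\alpha_n\in[0,1]$ with $\alpha_n\to0$ and $\sum_{n=0}^\infty\alpha_n=\infty$, and define $x_{n+1}=\alpha_nf(x_n)+(1-\alpha_n)Tx_n$ for $n\ge0$. Assume $\|Tx_n-x_n\|\to0$. Then $\{x_n\}$ converges strongly to $Q(f)$.
   Context: $F(T)=\{x\in D: Tx=x\}$ denotes the fixed point set of $T$. $\Pi_D$ denotes the set of contractions on $D$: maps $f:D\to D$ for which there is $\alpha\in(0,1)$ with $\|f(x)-f(y)\|\le\alpha\|x-y\|$ for all $x,y\in D$. For $f\in\Pi_D$ and $t\in(0,1)$, let $x_t\in D$ be the unique solution of $x_t=tf(x_t)+(1-t)Tx_t$. When $E$ is uniformly smooth and $F(T)\neq\emptyset$, the strong limit $\lim_{t\to0^+}x_t$ exists and lies in $F(T)$ (a known result of Xu); the map $Q:\Pi_D\to F(T)$ is defined by $Q(f):=\lim_{t\to0^+}x_t$. *)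

theory Defs
  imports "HOL-Analysis.Analysis"
begin

text \<open>Uniform smoothness: the modulus of smoothness
  rho(tau) = sup{(norm(x+y)+norm(x-y))/2 - 1 : norm x = 1, norm y = tau}
  satisfies rho(tau)/tau \<rightarrow> 0 as tau \<rightarrow> 0+, written out in epsilon-delta form.\<close>
definition uniformly_smooth :: "'a::real_normed_vector itself \<Rightarrow> bool" where
  "uniformly_smooth _ \<longleftrightarrow>
     (\<forall>\<epsilon>>0. \<exists>\<delta>>0. \<forall>(x::'a) y. norm x = 1 \<and> 0 < norm y \<and> norm y \<le> \<delta> \<longrightarrow>
        (norm (x + y) + norm (x - y)) / 2 - 1 \<le> \<epsilon> * norm y)"

definition nonexpansive_on :: "'a::real_normed_vector set \<Rightarrow> ('a \<Rightarrow> 'a) \<Rightarrow> bool" where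
  "nonexpansive_on D T \<longleftrightarrow> T ` D \<subseteq> D \<and> (\<forall>x\<in>D. \<forall>y\<in>D. norm (T x - T y) \<le> norm (x - y))"

definition fixpoints :: "'a set \<Rightarrow> ('a \<Rightarrow> 'a) \<Rightarrow> 'a set" where
  "fixpoints D T = {x\<in>D. T x = x}"

definition contractions :: "'a::real_normed_vector set \<Rightarrow> ('a \<Rightarrow> 'a) set" where
  "contractions D = {f. f ` D \<subseteq> D \<and>
     (\<exists>\<alpha>. 0 < \<alpha> \<and> \<alpha> < 1 \<and> (\<forall>x\<in>D. \<forall>y\<in>D. norm (f x - f y) \<le> \<alpha> * norm (x - y)))}"

definition implicit_pt :: "'a::real_normed_vector set \<Rightarrow> ('a \<Rightarrow> 'a) \<Rightarrow> ('a \<Rightarrow> 'a) \<Rightarrow> real \<Rightarrow> 'a" where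
  "implicit_pt D T f t = (THE x. x \<in> D \<and> x = t *\<^sub>R f x + (1 - t) *\<^sub>R T x)"

definition Qmap :: "'a::real_normed_vector set \<Rightarrow> ('a \<Rightarrow> 'a) \<Rightarrow> ('a \<Rightarrow> 'a) \<Rightarrow> 'a" where
  "Qmap D T f = Lim (at_right 0) (implicit_pt D T f)"

end

theory Submission
  imports Defs
begin

text \<open>Instead of the duality map, everything is expressed by how the norm changes along segments.
  Uniform smoothness makes the dual uniformly convex, which bounds the length of triangular systems
  of functionals and so gives uniform normal structure; by the argument of Gillespie and Williams
  nonexpansive maps then have fixed points on bounded closed convex sets, without any appeal to
  reflexivity. A fixed point that nearly minimises \<open>y \<mapsto> limsup \<parallel>path t - y\<parallel>\<close> must be close to the
  path, while fixed points close to the path are close to each other; hence the path converges,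
  to \<open>p\<close> say. Comparing an asymptotically fixed sequence with the path shows that
  \<open>f p - p\<close> asymptotically does not point away from \<open>p\<close>, and the iteration contracts to \<open>p\<close>
  because \<open>\<Sum>\<alpha> n = \<infinity>\<close>.\<close>

text \<open>The norm inequalities are derivatives in disguise. With \<open>j\<close> the norm-one
  functional supporting \<open>a\<close>, the bound
  \<open>norm (a - h w) <= (1 - c h) norm a\<close> says, up to a smoothness error, that
  \<open>j w >= c norm a\<close>. For a fixed point \<open>y\<close>, \<open>a = path t - y\<close>,
  \<open>w = f (path t) - y\<close> and \<open>c = 1\<close> this is the variational inequality
  \<open>j (f (path t) - path t) >= 0\<close>. The obstacle is scale. The implicit equation controls
  only steps of size \<open>t\<close>, and \<open>t\<close> tends to 0, whereas replacing
  \<open>path t\<close> by a nearby point costs an error that a step of vanishing size cannot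
  absorb. Uniform smoothness supplies a fixed step \<open>h\<close>, but only while
  \<open>norm a\<close> stays above a positive bound, because no norm is smooth at 0. Hence the
  thresholds \<open>r\<close>, the arguments by contradiction, and the order in which constants are
  chosen: first the separation \<open>r\<close>, then \<open>h\<close>, then tolerances that are
  small multiples of \<open>h\<close>.\<close>

section \<open>Uniform smoothness and supporting functionals\<close>

lemma uniformly_smoothD:
  assumes "uniformly_smooth TYPE('a::real_normed_vector)" "0 < \<epsilon>"
  obtains \<delta> where "0 < \<delta>" "\<And>x y :: 'a. norm y \<le> \<delta> * norm x \<Longrightarrow>
      norm (x + y) + norm (x - y) \<le> 2 * norm x + 2 * \<epsilon> * norm y"
proof -
  obtain \<delta> where \<delta>: "\<delta> > 0" and D: "\<And>(x::'a) y. norm x = 1 \<Longrightarrow> 0 < norm y \<Longrightarrow> norm y \<le> \<delta> \<Longrightarrow>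
        (norm (x + y) + norm (x - y)) / 2 - 1 \<le> \<epsilon> * norm y"
    using assms unfolding uniformly_smooth_def by meson
  show thesis
  proof
    fix x y :: 'a
    assume le: "norm y \<le> \<delta> * norm x"
    show "norm (x + y) + norm (x - y) \<le> 2 * norm x + 2 * \<epsilon> * norm y"
    proof (cases "y = 0")
      case False
      then have x: "norm x > 0"
        using le by (cases "x = 0") auto
      define u v where "u = x /\<^sub>R norm x" and "v = y /\<^sub>R norm x"
      have "(norm (u + v) + norm (u - v)) / 2 - 1 \<le> \<epsilon> * norm v"
      proof (rule D)
        show "norm u = 1" "0 < norm v" using x False by (auto simp: u_def v_def)
        show "norm v \<le> \<delta>" using le x by (simp add: v_def field_simps)
      qed
      moreover have "norm (u + v) = norm (x + y) / norm x"
        by (simp add: u_def v_def divide_inverse flip: scaleR_right_distrib)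
      moreover have "norm (u - v) = norm (x - y) / norm x"
        by (simp add: u_def v_def divide_inverse flip: scaleR_right_diff_distrib)
      moreover have "norm v = norm y / norm x" by (simp add: v_def divide_inverse)
      ultimately have "(norm (x + y) + norm (x - y)) / norm x \<le> 2 + 2 * \<epsilon> * (norm y / norm x)"
        by (simp add: add_divide_distrib)
      then show ?thesis using x by (simp add: pos_divide_le_eq distrib_right)
    qed simp
  qed (use \<delta> in simp)
qed

lemma norm_segment:
  fixes a w :: "'a::real_normed_vector"
  assumes "0 < t" "0 < h"
  shows "(h + t) * norm a \<le> h * norm (a - t *\<^sub>R w) + t * norm (a + h *\<^sub>R w)"
proof -
  have "(h + t) *\<^sub>R a = h *\<^sub>R (a - t *\<^sub>R w) + t *\<^sub>R (a + h *\<^sub>R w)"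
    by (simp add: algebra_simps)
  then have "norm ((h + t) *\<^sub>R a) \<le> norm (h *\<^sub>R (a - t *\<^sub>R w)) + norm (t *\<^sub>R (a + h *\<^sub>R w))"
    by (metis norm_triangle_ineq)
  then show ?thesis using assms by simp
qed

text \<open>The functional is the one-sided derivative of the norm at \<open>a\<close>; smoothness makes it additive.\<close>
lemma norming_functional:
  fixes a :: "'a::real_normed_vector"
  assumes us: "uniformly_smooth TYPE('a)" and a: "a \<noteq> 0"
  obtains F :: "'a \<Rightarrow> real" where "linear F" "\<And>v. F v \<le> norm v" "F a = norm a"
proof -
  define q where "q v h = (norm (a + h *\<^sub>R v) - norm a) / h" for v and h :: real
  define F where "F v = Inf (q v ` {0<..})" for v
  have lower: "- norm v \<le> q v h" if "h > 0" for v h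
  proof -
    have "norm a \<le> norm (a + h *\<^sub>R v) + h * norm v"
      using norm_triangle_ineq4[of "a + h *\<^sub>R v" "h *\<^sub>R v"] that by simp
    then show ?thesis using that by (simp add: q_def field_simps)
  qed
  have bdd: "bdd_below (q v ` {0<..})" for v
    by (rule bdd_belowI[of _ "- norm v"]) (use lower in auto)
  have F_le: "F v \<le> q v h" if "h > 0" for v h
    unfolding F_def by (rule cInf_lower) (use that bdd in auto)
  have F_ge: "c \<le> F v" if "\<And>h. h > 0 \<Longrightarrow> c \<le> q v h" for c v
    unfolding F_def by (rule cInf_greatest) (use that in auto)
  have q_mono: "q v s \<le> q v h" if "0 < s" "s \<le> h" for v s h
  proof -
    have "h *\<^sub>R (a + s *\<^sub>R v) = (h - s) *\<^sub>R a + s *\<^sub>R (a + h *\<^sub>R v)"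
      by (simp add: algebra_simps)
    then have "norm (h *\<^sub>R (a + s *\<^sub>R v)) \<le> norm ((h - s) *\<^sub>R a) + norm (s *\<^sub>R (a + h *\<^sub>R v))"
      by (metis norm_triangle_ineq)
    then have "h * norm (a + s *\<^sub>R v) \<le> (h - s) * norm a + s * norm (a + h *\<^sub>R v)"
      using that by simp
    then show ?thesis using that by (simp add: q_def field_simps)
  qed
  have near: "\<exists>h0>0. \<forall>h. 0 < h \<and> h \<le> h0 \<longrightarrow> q v h < F v + e" if "e > 0" for v e
  proof -
    have "\<exists>y\<in>q v ` {0<..}. y < F v + e"
      using cInf_lessD[of "q v ` {0<..}" "F v + e"] that by (auto simp: F_def)
    then obtain h0 where "h0 > 0" "q v h0 < F v + e" by auto
    then show ?thesis using q_mono by (metis order_le_less_trans)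
  qed
  have sub: "F (v + w) \<le> F v + F w" for v w
  proof (rule field_le_epsilon)
    fix e :: real assume "e > 0"
    obtain h1 where h1: "h1 > 0" "\<And>h. 0 < h \<Longrightarrow> h \<le> h1 \<Longrightarrow> q v h < F v + e/2"
      using near[of "e/2" v] \<open>e > 0\<close> by auto
    obtain h2 where h2: "h2 > 0" "\<And>h. 0 < h \<Longrightarrow> h \<le> h2 \<Longrightarrow> q w h < F w + e/2"
      using near[of "e/2" w] \<open>e > 0\<close> by auto
    define h where "h = min h1 h2"
    have h: "h > 0" "h \<le> h1" "h \<le> h2" using h1 h2 by (auto simp: h_def)
    have "2 *\<^sub>R (a + (h/2) *\<^sub>R (v + w)) = (a + h *\<^sub>R v) + (a + h *\<^sub>R w)"
      by (simp add: algebra_simps scaleR_2)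
    then have "norm (2 *\<^sub>R (a + (h/2) *\<^sub>R (v + w))) \<le> norm (a + h *\<^sub>R v) + norm (a + h *\<^sub>R w)"
      by (metis norm_triangle_ineq)
    then have "2 * norm (a + (h/2) *\<^sub>R (v + w)) \<le> norm (a + h *\<^sub>R v) + norm (a + h *\<^sub>R w)"
      by (simp only: norm_scaleR)
    then have "q (v + w) (h/2) \<le> q v h + q w h"
      unfolding q_def using h by (simp add: divide_simps mult_left_mono)
    then show "F (v + w) \<le> F v + F w + e"
      using F_le[of "h/2" "v + w"] h h1(2)[of h] h2(2)[of h] by linarith
  qed
  have F0: "F 0 = 0"
    unfolding F_def q_def by (subst image_cong[where g = "\<lambda>_. 0", OF refl]) auto
  \<comment> \<open>Subadditivity gives \<open>0 <= F v + F (- v)\<close>. Smoothness gives the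
    converse, since \<open>q v h + q (- v) h\<close> is the symmetric second difference of the norm
    divided by \<open>h\<close>.\<close>
  have neg: "F (- v) = - F v" for v
  proof -
    have "F v + F (- v) \<le> 0"
    proof (rule field_le_epsilon)
      fix e :: real assume e: "e > 0"
      obtain \<delta> where \<delta>: "\<delta> > 0" "\<And>x y :: 'a. norm y \<le> \<delta> * norm x \<Longrightarrow>
          norm (x + y) + norm (x - y) \<le> 2 * norm x + 2 * (e / (2 * (norm v + 1))) * norm y"
        using uniformly_smoothD[OF us, of "e / (2 * (norm v + 1))"] e
        by (metis add_nonneg_pos divide_pos_pos mult_pos_pos norm_ge_zero zero_less_numeral zero_less_one)
      define h where "h = \<delta> * norm a / (norm v + 1)"
      have h: "h > 0" using \<delta> a by (simp add: h_def add_nonneg_pos)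
      have "h * norm v \<le> \<delta> * norm a"
      proof -
        have "h * norm v \<le> h * (norm v + 1)" using h by simp
        also have "\<dots> = \<delta> * norm a" by (simp add: h_def add_nonneg_eq_0_iff)
        finally show ?thesis .
      qed
      then have "norm (h *\<^sub>R v) \<le> \<delta> * norm a" using h by simp
      from \<delta>(2)[OF this] have "norm (a + h *\<^sub>R v) + norm (a - h *\<^sub>R v)
          \<le> 2 * norm a + 2 * (e / (2 * (norm v + 1))) * (h * norm v)" using h by simp
      also have "2 * (e / (2 * (norm v + 1))) * (h * norm v) = h * e * (norm v / (norm v + 1))"
        using norm_ge_zero[of v] by (simp add: divide_simps)
      also have "\<dots> \<le> h * e * 1"
        using h e by (intro mult_left_mono divide_le_eq_1_pos[THEN iffD2] add_nonneg_pos) auto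
      finally have "(norm (a + h *\<^sub>R v) + norm (a - h *\<^sub>R v) - 2 * norm a) / h \<le> e"
        using h by (simp add: pos_divide_le_eq mult.commute)
      then have "q v h + q (- v) h \<le> e"
        by (simp add: q_def add_divide_distrib diff_divide_distrib)
      then show "F v + F (- v) \<le> 0 + e" using F_le[OF h, of v] F_le[OF h, of "- v"] by linarith
    qed
    then show ?thesis using sub[of v "- v"] F0 by simp
  qed
  have add: "F (v + w) = F v + F w" for v w
    using sub[of v w] sub[of "v + w" "- w"] neg[of w] by simp
  have scale_pos: "F (c *\<^sub>R v) = c * F v" if c: "c > 0" for c v
  proof -
    have *: "F (c *\<^sub>R v) \<ge> c * F v" if c: "c > 0" for c v
    proof (rule F_ge)
      fix h :: real assume "h > 0"
      then have "q (c *\<^sub>R v) h = c * q v (h * c)" using c by (simp add: q_def)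
      then show "c * F v \<le> q (c *\<^sub>R v) h"
        using F_le[of "h * c" v] c \<open>h > 0\<close> by simp
    qed
    have "F v \<ge> inverse c * F (c *\<^sub>R v)" using *[of "inverse c" "c *\<^sub>R v"] c by simp
    then show ?thesis using *[OF c, of v] c by (simp add: field_simps)
  qed
  have scale: "F (c *\<^sub>R v) = c * F v" for c v
  proof (cases c "0::real" rule: linorder_cases)
    case less
    then show ?thesis using scale_pos[of "- c" v] neg[of "c *\<^sub>R v"] by simp
  qed (use F0 scale_pos in auto)
  show thesis
  proof
    show "linear F" by (rule linearI) (use add scale in auto)
    show le: "F v \<le> norm v" for v
    proof -
      have "q v 1 \<le> norm v" using norm_triangle_ineq[of a v] by (simp add: q_def)
      then show ?thesis using F_le[of 1 v] by simp
    qed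
    have "norm a \<le> F a"
    proof (rule F_ge)
      fix h :: real assume "h > 0"
      then have "norm (a + h *\<^sub>R a) = (1 + h) * norm a"
        by (metis abs_of_pos add_pos_pos norm_scaleR scaleR_left_distrib scaleR_one zero_less_one)
      then show "norm a \<le> q a h" using \<open>h > 0\<close> by (simp add: q_def field_simps)
    qed
    then show "F a = norm a" using le[of a] by simp
  qed
qed

section \<open>Uniform convexity of the dual and triangular systems of functionals\<close>

text \<open>The dual of a uniformly smooth space is uniformly convex.\<close>
lemma dual_midpoint:
  assumes us: "uniformly_smooth TYPE('a::real_normed_vector)" and "0 < \<kappa>"
  obtains \<mu> where "0 < \<mu>" "\<mu> < 1"
    "\<And>(\<phi>::'a \<Rightarrow> real) \<psi> \<rho> y (v::'a). linear \<phi> \<Longrightarrow> linear \<psi> \<Longrightarrow> 0 \<le> \<rho> \<Longrightarrow> \<rho> \<le> 1 \<Longrightarrow>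
       (\<And>v. \<phi> v \<le> \<rho> * norm v) \<Longrightarrow> (\<And>v. \<psi> v \<le> \<rho> * norm v) \<Longrightarrow> norm y \<le> 1 \<Longrightarrow>
       \<kappa> \<le> \<phi> y - \<psi> y \<Longrightarrow> (\<phi> v + \<psi> v) / 2 \<le> (1 - \<mu>) * \<rho> * norm v"
proof -
  obtain \<delta> where \<delta>: "\<delta> > 0" "\<And>x y :: 'a. norm y \<le> \<delta> * norm x \<Longrightarrow>
      norm (x + y) + norm (x - y) \<le> 2 * norm x + 2 * (\<kappa>/4) * norm y"
    using uniformly_smoothD[OF us, of "\<kappa>/4"] \<open>0 < \<kappa>\<close> by auto
  define h where "h = min \<delta> (1 / \<kappa>)"
  have h: "h > 0" "h \<le> \<delta>" "h * \<kappa> \<le> 1"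
    using \<delta> \<open>0 < \<kappa>\<close> by (auto simp: h_def min_def field_simps)
  show thesis
  proof
    show "0 < h * \<kappa> / 4" "h * \<kappa> / 4 < 1" using h \<open>0 < \<kappa>\<close> by auto
    fix \<phi> \<psi> :: "'a \<Rightarrow> real" and \<rho> and y v :: 'a
    assume lin: "linear \<phi>" "linear \<psi>" and \<rho>: "0 \<le> \<rho>" "\<rho> \<le> 1"
      and \<phi>: "\<And>v. \<phi> v \<le> \<rho> * norm v" and \<psi>: "\<And>v. \<psi> v \<le> \<rho> * norm v"
      and y: "norm y \<le> 1" and \<kappa>: "\<kappa> \<le> \<phi> y - \<psi> y"
    \<comment> \<open>Evaluating \<open>\<phi>\<close> at \<open>v + z\<close> and
      \<open>\<psi>\<close> at \<open>v - z\<close> gains at least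
      \<open>\<rho> * h * \<kappa> * norm v\<close> from the separation at \<open>y\<close>, while
      smoothness costs at most half of that; halving the remainder gives
      \<open>\<mu> = h * \<kappa> / 4\<close>.\<close>
    define z where "z = (h * norm v) *\<^sub>R y"
    have nz: "norm z \<le> h * norm v" using y h by (simp add: z_def mult_left_le)
    also have "\<dots> \<le> \<delta> * norm v" using h by (intro mult_right_mono) auto
    finally have "norm (v + z) + norm (v - z) \<le> 2 * norm v + 2 * (\<kappa>/4) * norm z"
      by (rule \<delta>(2))
    also have "\<dots> \<le> 2 * norm v + 2 * (\<kappa>/4) * (h * norm v)"
      using nz \<open>0 < \<kappa>\<close> by (intro add_left_mono mult_left_mono) auto
    finally have "norm (v + z) + norm (v - z) \<le> norm v * (2 + h * \<kappa> / 2)" by (simp add: algebra_simps)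
    then have "\<rho> * (norm (v + z) + norm (v - z)) \<le> \<rho> * (norm v * (2 + h * \<kappa> / 2))"
      using \<rho> by (intro mult_left_mono)
    then have "\<phi> (v + z) + \<psi> (v - z) \<le> \<rho> * (norm v * (2 + h * \<kappa> / 2))"
      using \<phi>[of "v + z"] \<psi>[of "v - z"] by (simp add: distrib_left)
    moreover have "\<phi> (v + z) + \<psi> (v - z) = \<phi> v + \<psi> v + (h * norm v) * (\<phi> y - \<psi> y)"
      using lin by (simp add: linear_add linear_diff linear_cmul z_def algebra_simps)
    moreover have "\<rho> * (h * norm v * \<kappa>) \<le> h * norm v * (\<phi> y - \<psi> y)"
    proof -
      have "\<rho> * (h * norm v * \<kappa>) \<le> 1 * (h * norm v * \<kappa>)"
        using \<rho> h \<open>0 < \<kappa>\<close> by (intro mult_right_mono) auto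
      also have "\<dots> \<le> h * norm v * (\<phi> y - \<psi> y)"
        using h \<kappa> by (simp add: mult_left_mono)
      finally show ?thesis .
    qed
    moreover have "B \<le> R - P" if "A \<le> R" "A = B + S" "P \<le> S" for A B P R S :: real
      using that by simp
    ultimately have "\<phi> v + \<psi> v \<le> \<rho> * (norm v * (2 + h * \<kappa> / 2)) - \<rho> * (h * norm v * \<kappa>)"
      by blast
    also have "\<dots> = 2 * ((1 - h * \<kappa> / 4) * \<rho> * norm v)" by (simp add: algebra_simps)
    finally show "(\<phi> v + \<psi> v) / 2 \<le> (1 - h * \<kappa> / 4) * \<rho> * norm v" by simp
  qed
qed

text \<open>The averages of dyadic blocks of a triangular system of functionals lose a fixed proportion
  of their norm at each doubling, so the system cannot be long.\<close>
lemma dyadic_average: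
  fixes e :: "nat \<Rightarrow> 'a::real_normed_vector" and F :: "nat \<Rightarrow> 'a \<Rightarrow> real"
  assumes \<mu>: "0 < \<mu>" "\<mu> < 1"
    and mid: "\<And>\<phi> \<psi> \<rho> y v. linear \<phi> \<Longrightarrow> linear \<psi> \<Longrightarrow> 0 \<le> \<rho> \<Longrightarrow> \<rho> \<le> 1 \<Longrightarrow>
       (\<And>v::'a. \<phi> v \<le> \<rho> * norm v) \<Longrightarrow> (\<And>v. \<psi> v \<le> \<rho> * norm v) \<Longrightarrow> norm y \<le> 1 \<Longrightarrow>
       \<kappa> - \<eta> \<le> \<phi> y - \<psi> y \<Longrightarrow> (\<phi> v + \<psi> v) / 2 \<le> (1 - \<mu>) * \<rho> * norm v"
    and e: "\<And>m. norm (e m) \<le> 1"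
    and F: "\<And>n. 1 \<le> n \<Longrightarrow> n \<le> N \<Longrightarrow> linear (F n)" "\<And>n v. 1 \<le> n \<Longrightarrow> n \<le> N \<Longrightarrow> F n v \<le> norm v"
    and upper: "\<And>n m. 1 \<le> n \<Longrightarrow> n \<le> m \<Longrightarrow> m \<le> N \<Longrightarrow> \<kappa> \<le> F n (e m)"
    and lower: "\<And>n m. m < n \<Longrightarrow> n \<le> N \<Longrightarrow> F n (e m) \<le> \<eta>"
  shows "1 \<le> s \<Longrightarrow> s + 2 ^ k \<le> Suc N \<Longrightarrow> \<exists>\<psi>. linear \<psi> \<and> (\<forall>v. \<psi> v \<le> (1 - \<mu>) ^ k * norm v) \<and>
     (\<forall>m. s + 2 ^ k \<le> Suc m \<and> m \<le> N \<longrightarrow> \<kappa> \<le> \<psi> (e m)) \<and> (\<forall>m<s. \<psi> (e m) \<le> \<eta>)"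
proof (induction k arbitrary: s)
  case 0
  then show ?case using F[of s] upper lower by (intro exI[of _ "F s"]) auto
next
  case (Suc k)
  define s' where "s' = s + 2 ^ k"
  have s': "s' + 2 ^ k = s + 2 ^ Suc k" "1 \<le> s'" "s < s'" using Suc.prems by (auto simp: s'_def)
  obtain \<phi> where \<phi>: "linear \<phi>" "\<And>v. \<phi> v \<le> (1 - \<mu>) ^ k * norm v"
      "\<And>m. s' \<le> Suc m \<Longrightarrow> m \<le> N \<Longrightarrow> \<kappa> \<le> \<phi> (e m)" "\<And>m. m < s \<Longrightarrow> \<phi> (e m) \<le> \<eta>"
    using Suc.IH[of s] Suc.prems by (auto simp: s'_def)
  obtain \<psi> where \<psi>: "linear \<psi>" "\<And>v. \<psi> v \<le> (1 - \<mu>) ^ k * norm v"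
      "\<And>m. s' + 2 ^ k \<le> Suc m \<Longrightarrow> m \<le> N \<Longrightarrow> \<kappa> \<le> \<psi> (e m)" "\<And>m. m < s' \<Longrightarrow> \<psi> (e m) \<le> \<eta>"
    using Suc.IH[of s'] Suc.prems s' by auto
  \<comment> \<open>Index \<open>s' - 1\<close> ends the first block and precedes the second: there
    \<open>\<phi>\<close> is at least \<open>\<kappa>\<close> and \<open>\<psi>\<close> at most
    \<open>\<eta>\<close>, the separation that \<open>mid\<close> asks for.\<close>
  have le: "(\<phi> v + \<psi> v) / 2 \<le> (1 - \<mu>) * (1 - \<mu>) ^ k * norm v" for v
  proof (rule mid[where y = "e (s' - 1)"])
    show "(1 - \<mu>) ^ k \<le> 1" using \<mu> by (intro power_le_one) auto
    have "\<kappa> \<le> \<phi> (e (s' - 1))" using s' Suc.prems by (intro \<phi>(3)) auto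
    moreover have "\<psi> (e (s' - 1)) \<le> \<eta>" using s' by (intro \<psi>(4)) auto
    ultimately show "\<kappa> - \<eta> \<le> \<phi> (e (s' - 1)) - \<psi> (e (s' - 1))" by simp
  qed (use \<phi> \<psi> \<mu> e in auto)
  show ?case
  proof (intro exI[of _ "\<lambda>v. (\<phi> v + \<psi> v) / 2"] conjI allI impI)
    show "linear (\<lambda>v. (\<phi> v + \<psi> v) / 2)"
      using \<phi>(1) \<psi>(1)
      by (intro linearI) (auto simp: linear_add linear_cmul field_simps)
    show "(\<phi> v + \<psi> v) / 2 \<le> (1 - \<mu>) ^ Suc k * norm v" for v using le by simp
    show "\<kappa> \<le> (\<phi> (e m) + \<psi> (e m)) / 2" if "s + 2 ^ Suc k \<le> Suc m \<and> m \<le> N" for m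
      using \<phi>(3)[of m] \<psi>(3)[of m] that s' by auto
    show "(\<phi> (e m) + \<psi> (e m)) / 2 \<le> \<eta>" if "m < s" for m
      using \<phi>(4)[of m] \<psi>(4)[of m] that s' by auto
  qed
qed

section \<open>Uniform normal structure\<close>

text \<open>Without a near-centre, points can be chosen successively at distance more than
  \<open>c\<close> from the average of their predecessors. The functionals norming these differences
  are at most \<open>\<eta>\<close> on earlier \<open>e m\<close> and at least
  \<open>\<kappa>\<close> on later ones. For \<open>2 ^ k\<close> of them the dyadic average would
  be at least \<open>\<kappa>\<close> on a vector of norm at most 1 although its norm is below
  \<open>\<kappa>\<close>.\<close>

lemma uniform_normal_structure_unit:
  assumes us: "uniformly_smooth TYPE('a::real_normed_vector)"
  obtains c where "0 < c" "c < 1"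
    "\<And>K::'a set. convex K \<Longrightarrow> K \<noteq> {} \<Longrightarrow> (\<And>x y. x \<in> K \<Longrightarrow> y \<in> K \<Longrightarrow> norm (x - y) \<le> 1) \<Longrightarrow>
       \<exists>z\<in>K. \<forall>y\<in>K. norm (z - y) \<le> c"
proof -
  obtain \<delta> where \<delta>: "\<delta> > 0" "\<And>x y :: 'a. norm y \<le> \<delta> * norm x \<Longrightarrow>
      norm (x + y) + norm (x - y) \<le> 2 * norm x + 2 * (1/4) * norm y"
    using uniformly_smoothD[OF us, of "1/4"] by auto
  define h where "h = min 1 (\<delta> / 2)"
  have h: "0 < h" "h \<le> 1" "h \<le> \<delta> / 2" using \<delta> by (auto simp: h_def)
  \<comment> \<open>The estimate in \<open>up\<close> leaves
    \<open>15/16 - 2/16 - 8/16 = 5/16\<close> of \<open>h\<close>, more than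
    \<open>\<kappa>\<close>; the gap \<open>\<kappa> - \<eta>\<close> is again
    \<open>h / 16\<close>.\<close>
  define \<kappa> \<eta> where "\<kappa> = h / 8" and "\<eta> = h / 16"
  have \<eta>: "0 < \<eta>" "\<eta> \<le> 1/16" "h - h * \<eta> \<ge> h * (15/16)" using h by (auto simp: \<eta>_def)
  obtain \<mu> where \<mu>: "0 < \<mu>" "\<mu> < 1"
    and mid: "\<And>(\<phi>::'a \<Rightarrow> real) \<psi> \<rho> y (v::'a). linear \<phi> \<Longrightarrow> linear \<psi> \<Longrightarrow> 0 \<le> \<rho> \<Longrightarrow> \<rho> \<le> 1 \<Longrightarrow>
       (\<And>v. \<phi> v \<le> \<rho> * norm v) \<Longrightarrow> (\<And>v. \<psi> v \<le> \<rho> * norm v) \<Longrightarrow> norm y \<le> 1 \<Longrightarrow>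
       \<kappa> - \<eta> \<le> \<phi> y - \<psi> y \<Longrightarrow> (\<phi> v + \<psi> v) / 2 \<le> (1 - \<mu>) * \<rho> * norm v"
    using dual_midpoint[OF us, of "\<kappa> - \<eta>"] h by (auto simp: \<kappa>_def \<eta>_def)
  obtain k where k: "(1 - \<mu>) ^ k < \<kappa>"
    using real_arch_pow_inv[of \<kappa> "1 - \<mu>"] \<mu> h by (auto simp: \<kappa>_def)
  define N :: nat where "N = 2 ^ k"
  have N: "N \<ge> 1" by (simp add: N_def)
  \<comment> \<open>If an average of at most \<open>N\<close> numbers, each at most 1, exceeds
    \<open>1 - \<eta> / N\<close>, then each of them is at least \<open>1 - \<eta>\<close>; this is
    how \<open>F_ge\<close> passes from the average to single points.\<close>
  define c where "c = 1 - \<eta> / N"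
  have Nc: "N * (1 - c) = \<eta>" using N by (simp add: c_def)
  have "\<eta> / N \<le> \<eta>" using N \<eta> by (simp add: divide_le_eq mult_le_cancel_left1)
  then have c: "0 < c" "c < 1" using \<eta> N by (auto simp: c_def)
  show thesis
  proof
    fix K :: "'a set"
    assume K: "convex K" "K \<noteq> {}" and diam: "\<And>x y. x \<in> K \<Longrightarrow> y \<in> K \<Longrightarrow> norm (x - y) \<le> 1"
    show "\<exists>z\<in>K. \<forall>y\<in>K. norm (z - y) \<le> c"
    proof (rule ccontr)
      assume "\<not> ?thesis"
      then have far: "\<exists>y\<in>K. c < norm (y - z)" if "z \<in> K" for z
        using that by (metis norm_minus_commute not_le)
      define avg where "avg X n = (\<Sum>i<n. (1 / real n) *\<^sub>R X i)" for X :: "nat \<Rightarrow> 'a" and n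
      have avg_in: "avg X n \<in> K" if "\<And>i. i < n \<Longrightarrow> X i \<in> K" "0 < n" for X n
        unfolding avg_def by (rule convex_sum) (use K that in auto)
      have "\<exists>X. \<forall>n. X n \<in> K \<and> (0 < n \<longrightarrow> c < norm (X n - avg X n))"
      proof (rule dependent_wellorder_choice)
        fix r and X Y :: "nat \<Rightarrow> 'a" and n
        assume "\<And>i. i < n \<Longrightarrow> X i = Y i"
        then have "avg X n = avg Y n" by (simp add: avg_def)
        then show "(r \<in> K \<and> (0 < n \<longrightarrow> c < norm (r - avg X n))) =
            (r \<in> K \<and> (0 < n \<longrightarrow> c < norm (r - avg Y n)))" by simp
      next
        fix n and X :: "nat \<Rightarrow> 'a"
        assume "\<And>i. i < n \<Longrightarrow> X i \<in> K \<and> (0 < i \<longrightarrow> c < norm (X i - avg X i))"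
        then have "0 < n \<Longrightarrow> avg X n \<in> K" by (intro avg_in) auto
        then show "\<exists>r. r \<in> K \<and> (0 < n \<longrightarrow> c < norm (r - avg X n))"
          using far[of "avg X n"] K(2) by (cases "n = 0") auto
      qed
      then obtain X where X: "\<And>n. X n \<in> K" "\<And>n. 0 < n \<Longrightarrow> c < norm (X n - avg X n)"
        by blast
      have "\<exists>F. linear F \<and> (\<forall>v. F v \<le> norm v) \<and>
              (0 < n \<longrightarrow> F (X n - avg X n) = norm (X n - avg X n))" for n
      proof (cases "X n - avg X n = 0")
        case True
        then have "n = 0" using X(2)[of n] c by (cases "n = 0") auto
        then show ?thesis by (intro exI[of _ "\<lambda>_. 0"]) (simp add: linear_zero)
      next
        case False
        then show ?thesis using norming_functional[OF us] by metis
      qed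
      then obtain F where lin: "\<And>n. linear (F n)" and F_le: "\<And>n v. F n v \<le> norm v"
        and F_norm: "\<And>n. 0 < n \<Longrightarrow> F n (X n - avg X n) = norm (X n - avg X n)"
        by metis
      have F_ge: "1 - \<eta> \<le> F n (X n - X i)" if "i < n" "n \<le> N" for n i
      proof -
        have n: "0 < n" using that by simp
        have le1: "F n (X n - X j) \<le> 1" for j
          using F_le[of n "X n - X j"] diam[OF X(1) X(1), of n j] by linarith
        have "X n - avg X n = (\<Sum>j<n. (1 / real n) *\<^sub>R (X n - X j))"
          using n by (simp add: avg_def scaleR_right_diff_distrib sum_subtractf scaleR_left.sum[symmetric]
              del: scaleR_left.sum)
        then have "F n (X n - avg X n) = (\<Sum>j<n. (1 / real n) * F n (X n - X j))"
          by (simp add: linear_sum[OF lin] linear_cmul[OF lin])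
        then have "c < (\<Sum>j<n. (1 / real n) * F n (X n - X j))"
          using F_norm[OF n] X(2)[OF n] by simp
        then have "c < (\<Sum>j<n. F n (X n - X j)) / real n"
          by (simp add: sum_divide_distrib)
        then have "n * c < (\<Sum>j<n. F n (X n - X j))" using n by (simp add: field_simps)
        also have "\<dots> = F n (X n - X i) + (\<Sum>j\<in>{..<n} - {i}. F n (X n - X j))"
          using that by (subst sum.remove[of _ i]) auto
        also have "(\<Sum>j\<in>{..<n} - {i}. F n (X n - X j)) \<le> (\<Sum>j\<in>{..<n} - {i}. 1)"
          by (intro sum_mono le1)
        also have "\<dots> = n - 1" using that by simp
        finally have "1 - n * (1 - c) \<le> F n (X n - X i)" using n by (simp add: algebra_simps of_nat_diff)
        moreover have "n * (1 - c) \<le> N * (1 - c)" using that c by (intro mult_right_mono) auto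
        ultimately show ?thesis using Nc by linarith
      qed
      define e where "e m = X m - X 0" for m
      have ne: "norm (e m) \<le> 1" for m using diam X(1) by (simp add: e_def)
      have low: "F n (e m) \<le> \<eta>" if "m < n" "n \<le> N" for n m
      proof -
        have "e m = (X n - X 0) - (X n - X m)" by (simp add: e_def)
        then have "F n (e m) = F n (X n - X 0) - F n (X n - X m)" by (metis linear_diff[OF lin])
        moreover have "F n (X n - X 0) \<le> 1"
          using F_le[of n "X n - X 0"] diam[OF X(1) X(1), of n 0] by linarith
        ultimately show ?thesis using F_ge[OF that] by linarith
      qed
      \<comment> \<open>If \<open>F n (e m)\<close> were small for \<open>n < m\<close>, then
        \<open>F m\<close> and \<open>- F n\<close> would both nearly norm
        \<open>a = e m - e n\<close>, yet differ on \<open>e m\<close>, where \<open>F m\<close> is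
        nearly 1. Smoothness at \<open>a\<close> in direction \<open>e m\<close> excludes
        this.\<close>
      have up: "\<kappa> \<le> F n (e m)" if "1 \<le> n" "n \<le> m" "m \<le> N" for n m
      proof (cases "n = m")
        case True
        then show ?thesis using F_ge[of 0 n] that \<eta> h by (simp add: e_def \<kappa>_def)
      next
        case False
        define a y where "a = X m - X n" and "y = h *\<^sub>R e m"
        have Fm: "1 - \<eta> \<le> F m a" "1 - \<eta> \<le> F m (e m)"
          using F_ge[of n m] F_ge[of 0 m] that False by (auto simp: a_def e_def)
        have na: "1 - \<eta> \<le> norm a" "norm a \<le> 1"
          using Fm F_le[of m a] diam[OF X(1) X(1)] by (auto simp: a_def)
        have ny: "norm y \<le> h" using ne[of m] h by (simp add: y_def mult_left_le)
        also have "h \<le> \<delta> * (1/2)" using h by simp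
        also have "\<dots> \<le> \<delta> * norm a" using na \<eta> \<delta> by (intro mult_left_mono) auto
        finally have "norm (a + y) + norm (a - y) \<le> 2 * norm a + 2 * (1/4) * norm y" by (rule \<delta>(2))
        also have "\<dots> \<le> 2 + h / 2" using na ny by simp
        finally have "F m (a + y) + F n (y - a) \<le> 2 + h / 2"
          using F_le[of m "a + y"] F_le[of n "y - a"] by (simp add: norm_minus_commute)
        moreover have "F m (a + y) = F m a + h * F m (e m)"
          by (simp add: y_def linear_add[OF lin] linear_cmul[OF lin])
        moreover have "F n (y - a) = h * F n (e m) - F n (e m) + F n (e n)"
        proof -
          have "a = e m - e n" by (simp add: a_def e_def)
          then show ?thesis by (simp add: y_def linear_diff[OF lin] linear_cmul[OF lin])
        qed
        moreover have "1 - \<eta> \<le> F n (e n)" using F_ge[of 0 n] that by (simp add: e_def)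
        moreover have "h * (1 - \<eta>) \<le> h * F m (e m)" using Fm h by (intro mult_left_mono) auto
        ultimately have *: "h * (15/16) - 2 * \<eta> - h / 2 \<le> (1 - h) * F n (e m)"
          using Fm \<eta> by (simp add: algebra_simps)
        show ?thesis
        proof (rule ccontr)
          assume "\<not> ?thesis"
          then have "(1 - h) * F n (e m) \<le> (1 - h) * \<kappa>" using h by (intro mult_left_mono) auto
          also have "\<dots> \<le> \<kappa>" using h by (simp add: \<kappa>_def)
          finally show False using * h by (simp add: \<kappa>_def \<eta>_def)
        qed
      qed
      have "\<exists>\<psi>. linear \<psi> \<and> (\<forall>v. \<psi> v \<le> (1 - \<mu>) ^ k * norm v) \<and>
          (\<forall>m. 1 + 2 ^ k \<le> Suc m \<and> m \<le> N \<longrightarrow> \<kappa> \<le> \<psi> (e m)) \<and> (\<forall>m<1. \<psi> (e m) \<le> \<eta>)"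
      proof (rule dyadic_average[where F = F])
        show "1 + 2 ^ k \<le> Suc N" by (simp add: N_def)
      qed (rule \<mu> mid ne lin F_le up low order_refl; assumption)+
      then obtain \<psi> where \<psi>: "\<And>v. \<psi> v \<le> (1 - \<mu>) ^ k * norm v"
          "\<And>m. 1 + 2 ^ k \<le> Suc m \<Longrightarrow> m \<le> N \<Longrightarrow> \<kappa> \<le> \<psi> (e m)"
        by blast
      have "\<kappa> \<le> \<psi> (e N)" by (intro \<psi>(2)) (auto simp: N_def)
      also have "\<dots> \<le> (1 - \<mu>) ^ k * norm (e N)" by (rule \<psi>(1))
      also have "\<dots> \<le> (1 - \<mu>) ^ k * 1" using ne \<mu> by (intro mult_left_mono) auto
      finally show False using k by simp
    qed
  qed (use c in auto)
qed

lemma uniform_normal_structure: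
  assumes us: "uniformly_smooth TYPE('a::real_normed_vector)"
  obtains c where "0 < c" "c < 1"
    "\<And>(K::'a set) d. convex K \<Longrightarrow> K \<noteq> {} \<Longrightarrow> 0 < d \<Longrightarrow>
       (\<And>x y. x \<in> K \<Longrightarrow> y \<in> K \<Longrightarrow> norm (x - y) \<le> d) \<Longrightarrow>
       \<exists>z\<in>K. \<forall>y\<in>K. norm (z - y) \<le> c * d"
proof -
  obtain c where c: "0 < c" "c < 1" and
    unit: "\<And>K::'a set. convex K \<Longrightarrow> K \<noteq> {} \<Longrightarrow> (\<And>x y. x \<in> K \<Longrightarrow> y \<in> K \<Longrightarrow> norm (x - y) \<le> 1) \<Longrightarrow>
       \<exists>z\<in>K. \<forall>y\<in>K. norm (z - y) \<le> c"
    using uniform_normal_structure_unit[OF us] by blast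
  show thesis
  proof
    fix K :: "'a set" and d :: real
    assume K: "convex K" "K \<noteq> {}" and d: "0 < d"
      and diam: "\<And>x y. x \<in> K \<Longrightarrow> y \<in> K \<Longrightarrow> norm (x - y) \<le> d"
    have scale: "norm (x /\<^sub>R d - y /\<^sub>R d) = norm (x - y) / d" for x y :: 'a
      using d by (simp add: divide_inverse flip: scaleR_right_diff_distrib)
    have "\<exists>z\<in>(\<lambda>x. x /\<^sub>R d) ` K. \<forall>y\<in>(\<lambda>x. x /\<^sub>R d) ` K. norm (z - y) \<le> c"
    proof (rule unit)
      show "convex ((\<lambda>x. x /\<^sub>R d) ` K)" using K(1) by (rule convex_scaling)
    qed (use K d diam in \<open>auto simp: scale\<close>)
    then obtain z where "z \<in> K" "\<forall>y\<in>K. norm (z /\<^sub>R d - y /\<^sub>R d) \<le> c" by blast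
    then show "\<exists>z\<in>K. \<forall>y\<in>K. norm (z - y) \<le> c * d"
      unfolding scale using d by (auto simp: pos_divide_le_eq)
  qed (use c in auto)
qed

section \<open>Fixed points of nonexpansive maps on bounded closed convex sets\<close>

text \<open>Gillespie and Williams: pass to the least invariant closed convex set \<open>S\<close> containing a
  near-centre \<open>z\<close>, so that \<open>S\<close> is the closed convex hull of \<open>z\<close> and \<open>T ` S\<close>; the
  centres of \<open>S\<close> of radius \<open>r\<close> then form an invariant set.\<close>
lemma invariant_subset_of_centers:
  fixes K :: "'a::real_normed_vector set"
  assumes K: "closed K" "convex K" "T ` K \<subseteq> K"
    and nonexp: "\<And>x y. x \<in> K \<Longrightarrow> y \<in> K \<Longrightarrow> norm (T x - T y) \<le> norm (x - y)"
    and z: "z \<in> K" "\<And>y. y \<in> K \<Longrightarrow> norm (z - y) \<le> r"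
  obtains K' where "K' \<subseteq> K" "K' \<noteq> {}" "closed K'" "convex K'" "T ` K' \<subseteq> K'"
    "\<And>x y. x \<in> K' \<Longrightarrow> y \<in> K' \<Longrightarrow> norm (x - y) \<le> r"
proof -
  define \<L> where "\<L> = {L. L \<subseteq> K \<and> closed L \<and> convex L \<and> z \<in> L \<and> T ` L \<subseteq> L}"
  define S where "S = \<Inter>\<L>"
  define C where "C = closure (convex hull (insert z (T ` S)))"
  have "K \<in> \<L>" using K z by (auto simp: \<L>_def)
  then have S: "S \<subseteq> K" "closed S" "convex S" "z \<in> S"
    unfolding S_def by (auto simp: \<L>_def intro: convex_Inter)
  have TS: "T ` S \<subseteq> S"
    unfolding S_def by (rule Inter_greatest) (auto simp: \<L>_def)
  have CS: "C \<subseteq> S"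
    unfolding C_def using S TS by (intro closure_minimal hull_minimal) auto
  have TSC: "insert z (T ` S) \<subseteq> C"
    unfolding C_def by (rule subset_trans[OF hull_subset closure_subset])
  have "closed C" "convex C" by (simp_all add: C_def convex_closure)
  moreover have "C \<subseteq> K" "z \<in> C" using CS S(1) TSC by simp_all
  moreover have "T ` C \<subseteq> C" using image_mono[OF CS, of T] TSC by blast
  ultimately have "C \<in> \<L>" unfolding \<L>_def by simp
  then have SC: "S \<subseteq> C" by (auto simp: S_def)
  define K' where "K' = S \<inter> (\<Inter>k\<in>S. cball k r)"
  show thesis
  proof
    show "K' \<subseteq> K" using S by (auto simp: K'_def)
    have "z \<in> K'" using S z by (auto simp: K'_def dist_norm norm_minus_commute)
    then show "K' \<noteq> {}" by auto
    show "closed K'" unfolding K'_def using S by (intro closed_Int closed_INT) auto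
    show "convex K'" unfolding K'_def using S by (intro convex_Int convex_INT) auto
    show "norm (x - y) \<le> r" if "x \<in> K'" "y \<in> K'" for x y
      using that by (auto simp: K'_def dist_norm norm_minus_commute)
    show "T ` K' \<subseteq> K'"
    proof clarify
      fix y assume y: "y \<in> K'"
      then have yS: "y \<in> S" "T y \<in> S" using TS by (auto simp: K'_def)
      \<comment> \<open>The ball of radius \<open>r\<close> about \<open>T y\<close> contains the
        image of \<open>S\<close> by nonexpansiveness, and \<open>z\<close> because \<open>z\<close>
        is within \<open>r\<close> of all of \<open>K\<close>; hence it contains their closed convex
        hull \<open>C\<close> and thus \<open>S\<close>.\<close>
      have "T k \<in> cball (T y) r" if "k \<in> S" for k
      proof -
        have "norm (T y - T k) \<le> norm (y - k)" using yS that S by (intro nonexp) auto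
        also have "\<dots> \<le> r" using y that by (auto simp: K'_def dist_norm norm_minus_commute)
        finally show ?thesis by (simp add: dist_norm)
      qed
      moreover have "z \<in> cball (T y) r"
        using z(2)[of "T y"] yS S by (auto simp: dist_norm norm_minus_commute)
      ultimately have "C \<subseteq> cball (T y) r"
        unfolding C_def by (intro closure_minimal hull_minimal) auto
      then have "\<forall>k\<in>S. T y \<in> cball k r" using SC by (auto simp: dist_commute)
      then show "T y \<in> K'" using yS by (auto simp: K'_def)
    qed
  qed
qed

text \<open>Each passage to centres keeps invariance and multiplies the diameter bound by the same
  \<open>c < 1\<close>. Completeness gives a point \<open>z\<close> in all the nested sets;
  \<open>T z\<close> also lies in all of them, so the two coincide.\<close>

lemma nonexpansive_fixed_point:
  fixes K :: "'a::banach set"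
  assumes us: "uniformly_smooth TYPE('a)"
    and K: "closed K" "convex K" "bounded K" "K \<noteq> {}" "T ` K \<subseteq> K"
    and nonexp: "\<And>x y. x \<in> K \<Longrightarrow> y \<in> K \<Longrightarrow> norm (T x - T y) \<le> norm (x - y)"
  obtains z where "z \<in> K" "T z = z"
proof -
  obtain c where c: "0 < c" "c < 1"
    and center: "\<And>(C::'a set) d. convex C \<Longrightarrow> C \<noteq> {} \<Longrightarrow> 0 < d \<Longrightarrow>
       (\<And>x y. x \<in> C \<Longrightarrow> y \<in> C \<Longrightarrow> norm (x - y) \<le> d) \<Longrightarrow>
       \<exists>z\<in>C. \<forall>y\<in>C. norm (z - y) \<le> c * d"
    using uniform_normal_structure[OF us] by blast
  obtain B where B: "\<And>x. x \<in> K \<Longrightarrow> norm x \<le> B" "0 < B"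
    using K(3) by (auto simp: bounded_pos)
  define P where "P n S \<longleftrightarrow> S \<subseteq> K \<and> S \<noteq> {} \<and> closed S \<and> convex S \<and> T ` S \<subseteq> S \<and>
      (\<forall>x\<in>S. \<forall>y\<in>S. norm (x - y) \<le> c ^ n * (2 * B))" for n S
  have "\<exists>S. \<forall>n. P n (S n) \<and> S (Suc n) \<subseteq> S n"
  proof (rule dependent_nat_choice)
    have "norm (x - y) \<le> 2 * B" if "x \<in> K" "y \<in> K" for x y
      using norm_triangle_ineq4[of x y] B(1)[OF that(1)] B(1)[OF that(2)] by linarith
    then show "\<exists>S. P 0 S" using K by (intro exI[of _ K]) (auto simp: P_def)
  next
    fix S n assume P: "P n S"
    obtain z where z: "z \<in> S" "\<And>y. y \<in> S \<Longrightarrow> norm (z - y) \<le> c * (c ^ n * (2 * B))"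
      using center[of S "c ^ n * (2 * B)"] P c B by (auto simp: P_def)
    obtain S' where "S' \<subseteq> S" "S' \<noteq> {}" "closed S'" "convex S'" "T ` S' \<subseteq> S'"
      "\<And>x y. x \<in> S' \<Longrightarrow> y \<in> S' \<Longrightarrow> norm (x - y) \<le> c * (c ^ n * (2 * B))"
    proof (rule invariant_subset_of_centers[of S T z "c * (c ^ n * (2 * B))"])
      show "norm (T x - T y) \<le> norm (x - y)" if "x \<in> S" "y \<in> S" for x y
        using that P by (intro nonexp) (auto simp: P_def)
    qed (use P z in \<open>auto simp: P_def\<close>)
    then show "\<exists>S'. P (Suc n) S' \<and> S' \<subseteq> S" using P by (intro exI[of _ S']) (auto simp: P_def mult.assoc)
  qed
  then obtain S where P: "\<And>n. P n (S n)" and dec: "\<And>n. S (Suc n) \<subseteq> S n" by blast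
  have anti: "S n \<subseteq> S m" if "m \<le> n" for m n
    by (rule lift_Suc_antimono_le[of S, OF dec that])
  have small: "\<exists>n. c ^ n * (2 * B) < e" if "e > 0" for e
    using real_arch_pow_inv[of "e / (2 * B)" c] that B c by (auto simp: pos_less_divide_eq)
  obtain z where z: "\<And>n. z \<in> S n"
  proof (rule decreasing_closed_nest[of S])
    show "\<exists>n. \<forall>x\<in>S n. \<forall>y\<in>S n. dist x y < e" if "e > 0" for e
    proof -
      obtain n where n: "c ^ n * (2 * B) < e" using small[OF \<open>e > 0\<close>] by blast
      have "dist x y < e" if "x \<in> S n" "y \<in> S n" for x y
        using P[of n] that n unfolding P_def dist_norm by (meson order_le_less_trans)
      then show ?thesis by blast
    qed
  qed (use P anti in \<open>auto simp: P_def\<close>)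
  have "norm (T z - z) \<le> e" if "e > 0" for e
  proof -
    obtain n where "c ^ n * (2 * B) < e" using small[OF \<open>e > 0\<close>] by blast
    moreover have "T z \<in> S n" using P[of n] z[of n] by (auto simp: P_def)
    ultimately show ?thesis using P[of n] z[of n] unfolding P_def by (meson order_less_imp_le order_trans)
  qed
  then have "norm (T z - z) \<le> 0" by (rule field_le_epsilon[of _ 0, simplified])
  then show thesis using that[of z] z[of 0] P[of 0] by (auto simp: P_def)
qed

section \<open>From infinitesimal steps to steps of fixed size\<close>

text \<open>Moving from \<open>a\<close> by a tiny step \<open>t\<close> against \<open>w\<close> shortens it at rate \<open>c\<close>; by convexity
  moving along \<open>w\<close> lengthens it at rate \<open>c\<close> at every scale, and smoothness turns this into
  shortening at a fixed scale \<open>h\<close> independent of \<open>t\<close>. This replaces the duality map.\<close>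
lemma descent_at_fixed_scale:
  assumes us: "uniformly_smooth TYPE('a::real_normed_vector)" and pos: "0 < r" "0 < M" "0 < \<eta>"
  obtains h where "0 < h" "h < 1"
    "\<And>(a::'a) w t c e. r \<le> norm a \<Longrightarrow> norm w \<le> M \<Longrightarrow> 0 < t \<Longrightarrow>
       norm (a - t *\<^sub>R w) \<le> (1 - c * t) * norm a + t * e \<Longrightarrow>
       norm (a - h *\<^sub>R w) \<le> (1 - c * h) * norm a + h * (e + \<eta>)"
proof -
  define \<epsilon> where "\<epsilon> = \<eta> / (2 * M)"
  have \<epsilon>: "0 < \<epsilon>" using pos by (simp add: \<epsilon>_def)
  obtain \<delta> where \<delta>: "\<delta> > 0" "\<And>x y :: 'a. norm y \<le> \<delta> * norm x \<Longrightarrow>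
      norm (x + y) + norm (x - y) \<le> 2 * norm x + 2 * \<epsilon> * norm y"
    using uniformly_smoothD[OF us \<epsilon>] by blast
  \<comment> \<open>This makes
    \<open>norm (h *\<^sub>R w) <= \<delta> * r <= \<delta> * norm a\<close>, so \<open>h\<close>
    depends on \<open>r\<close>, \<open>M\<close> and \<open>\<eta>\<close> but not on
    \<open>a\<close>, \<open>w\<close> or \<open>t\<close>. The choice of \<open>\<epsilon>\<close>
    turns the smoothness error into \<open>h * \<eta>\<close>.\<close>
  define h where "h = min (1/2) (\<delta> * r / M)"
  have h: "0 < h" "h < 1" "h * M \<le> \<delta> * r"
    using pos \<delta> by (auto simp: h_def min_def field_simps)
  show thesis
  proof
    fix a w :: 'a and t c e
    assume a: "r \<le> norm a" and w: "norm w \<le> M" and t: "0 < t"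
      and le: "norm (a - t *\<^sub>R w) \<le> (1 - c * t) * norm a + t * e"
    have "(h + t) * norm a \<le> h * norm (a - t *\<^sub>R w) + t * norm (a + h *\<^sub>R w)"
      by (rule norm_segment[OF t h(1)])
    also have "\<dots> \<le> h * ((1 - c * t) * norm a + t * e) + t * norm (a + h *\<^sub>R w)"
      using le h by (intro add_right_mono mult_left_mono) auto
    finally have "t * ((1 + h * c) * norm a) \<le> t * (norm (a + h *\<^sub>R w) + h * e)"
      by (simp add: algebra_simps)
    then have plus: "(1 + h * c) * norm a \<le> norm (a + h *\<^sub>R w) + h * e" using t by simp
    have hw: "norm (h *\<^sub>R w) \<le> h * M" using w h by simp
    also have "\<dots> \<le> \<delta> * norm a" 
      using h(3) mult_left_mono[OF a, of \<delta>] \<delta>(1) by linarith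
    finally have "norm (a + h *\<^sub>R w) + norm (a - h *\<^sub>R w) \<le> 2 * norm a + 2 * \<epsilon> * norm (h *\<^sub>R w)"
      by (rule \<delta>(2))
    also have "\<dots> \<le> 2 * norm a + 2 * \<epsilon> * (h * M)"
      using hw \<epsilon> by (intro add_left_mono mult_left_mono) auto
    also have "2 * \<epsilon> * (h * M) = h * \<eta>" using pos by (simp add: \<epsilon>_def)
    finally show "norm (a - h *\<^sub>R w) \<le> (1 - c * h) * norm a + h * (e + \<eta>)"
      using plus by (simp add: algebra_simps)
  qed (use h in auto)
qed

lemma norm_combination_le:
  fixes u v :: "'a::real_normed_vector"
  assumes "0 \<le> s" "0 \<le> t" "norm u \<le> A" "norm v \<le> B"
  shows "norm (s *\<^sub>R u + t *\<^sub>R v) \<le> s * A + t * B"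
proof -
  have "norm (s *\<^sub>R u + t *\<^sub>R v) \<le> s * norm u + t * norm v"
    using norm_triangle_ineq[of "s *\<^sub>R u" "t *\<^sub>R v"] assms by simp
  also have "\<dots> \<le> s * A + t * B"
    using assms by (intro add_mono mult_left_mono) auto
  finally show ?thesis .
qed

lemma norm_add_diff_le:
  fixes u v w :: "'a::real_normed_vector"
  shows "norm (u + v - w) \<le> norm u + norm v + norm w"
  using norm_triangle_ineq[of u v] norm_triangle_ineq4[of "u + v" w] by linarith

section \<open>The implicit path and its convergence\<close>

locale viscosity =
  fixes D :: "'a::banach set" and T f :: "'a \<Rightarrow> 'a" and L :: real
  assumes us: "uniformly_smooth TYPE('a)"
    and D: "closed D" "convex D"
    and T: "nonexpansive_on D T"
    and f: "f ` D \<subseteq> D" "\<And>x y. x \<in> D \<Longrightarrow> y \<in> D \<Longrightarrow> norm (f x - f y) \<le> L * norm (x - y)"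
    and L: "0 < L" "L < 1"
    and fix_nonempty: "fixpoints D T \<noteq> {}"
begin

abbreviation path :: "real \<Rightarrow> 'a" where "path \<equiv> implicit_pt D T f"

lemma T_in: "x \<in> D \<Longrightarrow> T x \<in> D"
  and T_nonexp: "x \<in> D \<Longrightarrow> y \<in> D \<Longrightarrow> norm (T x - T y) \<le> norm (x - y)"
  using T by (auto simp: nonexpansive_on_def)

lemma f_in: "x \<in> D \<Longrightarrow> f x \<in> D"
  using f by auto

lemma f_nonexp: "x \<in> D \<Longrightarrow> y \<in> D \<Longrightarrow> norm (f x - f y) \<le> norm (x - y)"
  using f(2)[of x y] L mult_right_mono[of L 1 "norm (x - y)"] by simp

lemma fixD: "z \<in> fixpoints D T \<Longrightarrow> z \<in> D" "z \<in> fixpoints D T \<Longrightarrow> T z = z"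
  by (auto simp: fixpoints_def)

lemma path:
  assumes t: "0 < t" "t < 1"
  shows path_in: "path t \<in> D"
    and path_eq: "t *\<^sub>R f (path t) + (1 - t) *\<^sub>R T (path t) = path t"
proof -
  define g where "g x = t *\<^sub>R f x + (1 - t) *\<^sub>R T x" for x
  have "\<exists>!x\<in>D. g x = x"
  proof (rule Banach_fix)
    show "complete D" "D \<noteq> {}"
      using D fix_nonempty by (auto simp: complete_eq_closed fixpoints_def)
    show "t * L + (1 - t) < 1" using mult_strict_left_mono[of L 1 t] t L by simp
    show "0 \<le> t * L + (1 - t)" using t L by auto
    show "g ` D \<subseteq> D"
      unfolding g_def using t by (auto intro!: convexD[OF D(2) f_in T_in])
    show "dist (g x) (g y) \<le> (t * L + (1 - t)) * dist x y" if "x \<in> D" "y \<in> D" for x y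
    proof -
      have "g x - g y = t *\<^sub>R (f x - f y) + (1 - t) *\<^sub>R (T x - T y)"
        by (simp add: g_def algebra_simps)
      also have "norm \<dots> \<le> t * (L * norm (x - y)) + (1 - t) * norm (x - y)"
        using t that by (intro norm_combination_le f T_nonexp) auto
      finally show ?thesis by (simp add: dist_norm algebra_simps)
    qed
  qed
  then have "\<exists>!x. x \<in> D \<and> g x = x" .
  from theI'[OF this] have "(THE x. x \<in> D \<and> g x = x) \<in> D \<and>
      g (THE x. x \<in> D \<and> g x = x) = (THE x. x \<in> D \<and> g x = x)" .
  moreover have "path t = (THE x. x \<in> D \<and> g x = x)"
    unfolding implicit_pt_def g_def
    by (rule arg_cong[where f = The], rule ext, rule conj_cong[OF refl], rule eq_commute)
  ultimately have "path t \<in> D \<and> g (path t) = path t" by (simp only:)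
  then show "path t \<in> D" "t *\<^sub>R f (path t) + (1 - t) *\<^sub>R T (path t) = path t"
    unfolding g_def by (rule conjunct1, elim conjunct2)
qed

text \<open>Subtracting the drift removes the \<open>f\<close> term of the implicit equation and
  leaves only a \<open>T\<close> term of weight \<open>1 - t\<close>. Since \<open>y\<close> need
  not be fixed, the bound also serves for iterates; the defect of \<open>y\<close> is divided by
  \<open>t\<close>, and \<open>1 * t\<close> is written out, to match the premise of
  \<open>descent_at_fixed_scale\<close> with \<open>c = 1\<close>.\<close>

lemma path_step:
  assumes t: "0 < t" "t < 1" and y: "y \<in> D"
  shows "norm (path t - y - t *\<^sub>R (f (path t) - y)) \<le>
           (1 - 1 * t) * norm (path t - y) + t * (norm (T y - y) / t)"
proof -
  let ?x = "path t"
  have "?x - y - t *\<^sub>R (f ?x - y) =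
        (t *\<^sub>R f ?x + (1 - t) *\<^sub>R T ?x) - y - t *\<^sub>R (f ?x - y)"
    using path_eq[OF t] by simp
  also have "\<dots> = (1 - t) *\<^sub>R (T ?x - T y) + (1 - t) *\<^sub>R (T y - y)" by (simp add: algebra_simps)
  also have "norm \<dots> \<le> (1 - t) * norm (?x - y) + (1 - t) * norm (T y - y)"
    using t y path_in[OF t] by (intro norm_combination_le T_nonexp) auto
  also have "\<dots> \<le> (1 - t) * norm (?x - y) + 1 * norm (T y - y)"
    using t by (intro add_left_mono mult_right_mono) auto
  finally show ?thesis using t by simp
qed

text \<open>Here the direction \<open>f z - z\<close> does not depend on \<open>t\<close>, at the
  price of the rate \<open>1 - L\<close> instead of 1. One direction for all \<open>t\<close> is
  what allows \<open>z\<close> to be moved to a single new competitor.\<close>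

lemma path_step_fixpoint:
  assumes t: "0 < t" "t < 1" and z: "z \<in> fixpoints D T"
  shows "norm (path t - z - t *\<^sub>R (f z - z)) \<le> (1 - (1 - L) * t) * norm (path t - z)"
proof -
  let ?x = "path t"
  have "?x - z - t *\<^sub>R (f z - z) =
        (t *\<^sub>R f ?x + (1 - t) *\<^sub>R T ?x) - z - t *\<^sub>R (f z - z)"
    using path_eq[OF t] by simp
  also have "\<dots> = t *\<^sub>R (f ?x - f z) + (1 - t) *\<^sub>R (T ?x - T z)"
    using fixD(2)[OF z] by (simp add: algebra_simps)
  also have "norm \<dots> \<le> t * (L * norm (?x - z)) + (1 - t) * norm (?x - z)"
    using t path_in[OF t] fixD[OF z] by (intro norm_combination_le T_nonexp f) auto
  finally show ?thesis by (simp add: algebra_simps)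
qed

lemma path_bounded:
  assumes t: "0 < t" "t < 1" and z: "z \<in> fixpoints D T"
  shows "norm (path t - z) \<le> norm (f z - z) / (1 - L)"
proof -
  have "norm (path t - z) \<le> norm (path t - z - t *\<^sub>R (f z - z)) + t * norm (f z - z)"
    using norm_triangle_ineq[of "path t - z - t *\<^sub>R (f z - z)" "t *\<^sub>R (f z - z)"] t by simp
  also note path_step_fixpoint[OF assms]
  finally have "t * ((1 - L) * norm (path t - z)) \<le> t * norm (f z - z)"
    by (simp add: algebra_simps)
  then show ?thesis using t L by (simp add: pos_le_divide_eq mult.commute)
qed

text \<open>The implicit equation gives \<open>T x - x = t (T x - f x)\<close> at
  \<open>x = path t\<close>, and the second factor is bounded because the path is.\<close>

lemma path_asymptotically_fixed: "((\<lambda>t. norm (T (path t) - path t)) \<longlongrightarrow> 0) (at_right 0)"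
proof -
  obtain p where p: "p \<in> fixpoints D T" using fix_nonempty by auto
  define C where "C = 2 * (norm (f p - p) / (1 - L)) + norm (f p - p)"
  have "norm (T (path t) - path t) \<le> t * C" if t: "0 < t" "t < 1" for t
  proof -
    let ?x = "path t"
    have "?x \<in> D" "p \<in> D" using path_in[OF t] fixD[OF p] by auto
    then have "norm (f ?x - f p) \<le> norm (?x - p)" "norm (T ?x - T p) \<le> norm (?x - p)"
      by (auto intro: f_nonexp T_nonexp)
    moreover have "norm (T ?x - f ?x) \<le> norm (T ?x - T p) + norm (p - f p) + norm (f ?x - f p)"
      using norm_add_diff_le[of "T ?x - T p" "p - f p" "f ?x - f p"] fixD(2)[OF p] by simp
    ultimately have "norm (T ?x - f ?x) \<le> C"
      using path_bounded[OF t p] norm_minus_commute[of p "f p"] unfolding C_def by linarith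
    moreover have "T ?x - ?x = t *\<^sub>R (T ?x - f ?x)"

    proof -
      have "T ?x - ?x = T ?x - (t *\<^sub>R f ?x + (1 - t) *\<^sub>R T ?x)" using path_eq[OF t] by simp
      then show ?thesis by (simp add: algebra_simps)
    qed
    ultimately show ?thesis using t by (simp add: mult_left_mono)
  qed
  then have "\<forall>\<^sub>F t in at_right 0. norm (norm (T (path t) - path t)) \<le> t * C"
    by (intro eventually_at_rightI[of 0 1]) auto
  moreover have "((\<lambda>t. t * C) \<longlongrightarrow> 0) (at_right 0)" by (auto intro!: tendsto_eq_intros)
  ultimately show ?thesis by (rule Lim_null_comparison)
qed

text \<open>Sublevel sets of \<open>y \<mapsto> limsup \<parallel>path t - y\<parallel>\<close> are \<open>T\<close>-invariant because the path is asymptotically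
  fixed, so a sublevel close to the infimum contains a fixed point \<open>z\<close>. If the path stayed away
  from \<open>z\<close>, moving \<open>z\<close> towards \<open>f z\<close> would decrease the limsup below the infimum.\<close>
lemma path_near_fixpoints:
  assumes r: "0 < r"
  shows "\<forall>\<^sub>F t in at_right 0. \<exists>z\<in>fixpoints D T. norm (path t - z) < r"
proof (rule ccontr)
  assume neg: "\<not> ?thesis"
  \<comment> \<open>Small parameters restricted to the bad ones, where the path is at least
    \<open>r\<close> away from every fixed point; the negated claim says exactly that this filter is
    proper.\<close>
  define F where "F = inf (at_right 0) (principal {t. \<forall>z\<in>fixpoints D T. r \<le> norm (path t - z)})"
  have "F \<noteq> bot"
  proof
    assume "F = bot"
    then have "\<forall>\<^sub>F t in F. False" by simp
    then show False using neg by (simp add: F_def eventually_inf_principal not_le)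
  qed
  have F_le: "F \<le> at_right 0" by (simp add: F_def)
  have far: "\<forall>\<^sub>F t in F. \<forall>z\<in>fixpoints D T. r \<le> norm (path t - z)"
    by (simp add: F_def eventually_inf_principal)
  have t01: "\<forall>\<^sub>F t in F. 0 < t \<and> t < (1::real)"
    by (rule filter_leD[OF F_le]) (auto intro: eventually_at_rightI[of 0 1])
  have T_small: "\<forall>\<^sub>F t in F. norm (T (path t) - path t) < e" if "0 < e" for e
    using order_tendstoD(2)[OF path_asymptotically_fixed that] filter_leD[OF F_le] by blast
  obtain p where p: "p \<in> fixpoints D T" using fix_nonempty by auto
  define B where "B = norm (f p - p) / (1 - L)"
  have B: "0 \<le> B" "\<forall>\<^sub>F t in F. norm (path t - p) \<le> B"
    using L eventually_mono[OF t01] path_bounded[OF _ _ p] by (auto simp: B_def)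
  \<comment> \<open>\<open>Inf A\<close> is the infimum over \<open>y\<close> in \<open>D\<close> of
    the limsup of \<open>norm (path t - y)\<close> along \<open>F\<close>.\<close>
  define A where "A = {\<rho>. \<exists>y\<in>D. \<forall>\<^sub>F t in F. norm (path t - y) \<le> \<rho>}"
  have BA: "B \<in> A" using B fixD[OF p] by (auto simp: A_def)
  have "0 \<le> \<rho>" if "\<rho> \<in> A" for \<rho>
  proof -
    obtain y where "\<forall>\<^sub>F t in F. norm (path t - y) \<le> \<rho>" using \<open>\<rho> \<in> A\<close> by (auto simp: A_def)
    then obtain t where "norm (path t - y) \<le> \<rho>" using \<open>F \<noteq> bot\<close> eventually_happens' by blast
    then show ?thesis using norm_ge_zero order_trans by blast
  qed
  then have bdd: "bdd_below A" by (rule bdd_belowI)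
  \<comment> \<open>A bound for \<open>norm (f z - z)\<close> is needed before \<open>h\<close>,
    hence before \<open>z\<close> exists: \<open>2 * B + 2\<close> anticipates
    \<open>\<epsilon> <= 1\<close> and bounds the distance from \<open>p\<close> to any point of
    \<open>K\<close>.\<close>
  define M where "M = 2 * (2 * B + 2) + norm (f p - p) + 1"
  have M: "0 < M" unfolding M_def using B(1) by (intro add_nonneg_pos add_nonneg_nonneg mult_nonneg_nonneg) auto
  obtain h where h: "0 < h" "h < 1"
    and descent: "\<And>(a::'a) w t c e. r \<le> norm a \<Longrightarrow> norm w \<le> M \<Longrightarrow> 0 < t \<Longrightarrow>
       norm (a - t *\<^sub>R w) \<le> (1 - c * t) * norm a + t * e \<Longrightarrow>
       norm (a - h *\<^sub>R w) \<le> (1 - c * h) * norm a + h * (e + (1 - L) * r / 2)"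
    using descent_at_fixed_scale[OF us r M, of "(1 - L) * r / 2"] L r by auto
  \<comment> \<open>Moving \<open>z\<close> to \<open>z + h *\<^sub>R w\<close> will lower the bound
    by \<open>h * ((1 - L) * r) / 2\<close>, at least twice \<open>\<epsilon>\<close>: one
    \<open>\<epsilon>\<close> pays for \<open>\<rho>\<close> exceeding \<open>Inf A\<close>, the
    other for the slack in \<open>K\<close>.\<close>
  define \<epsilon> where "\<epsilon> = min 1 (h * ((1 - L) * r) / 4)"
  have \<epsilon>: "0 < \<epsilon>" "\<epsilon> \<le> 1" "\<epsilon> \<le> h * ((1 - L) * r) / 4" using h L r by (auto simp: \<epsilon>_def)
  obtain \<rho> where \<rho>: "\<rho> \<in> A" "\<rho> < Inf A + \<epsilon>"
    using cInf_lessD[of A "Inf A + \<epsilon>"] BA \<epsilon> by auto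
  have "\<rho> < B + \<epsilon>" using \<rho>(2) cInf_lower[OF BA bdd] by simp
  \<comment> \<open>The slack \<open>e\<close> makes this a genuine sublevel set of the limsup: it
    is closed, and \<open>T\<close> maps it into itself because the vanishing defect of the path is
    absorbed.\<close>
  define K where "K = {y\<in>D. \<forall>e>0. \<forall>\<^sub>F t in F. norm (path t - y) \<le> \<rho> + e}"
  have K_p: "norm (y - p) \<le> 2 * B + 2" if "y \<in> K" for y
  proof -
    have "\<forall>\<^sub>F t in F. norm (path t - y) \<le> \<rho> + 1" using that by (simp add: K_def)
    then have "\<forall>\<^sub>F t in F. norm (y - p) \<le> 2 * B + 2"
      using B(2)
    proof eventually_elim
      case (elim t)
      then show ?case
        using norm_triangle_ineq4[of "path t - p" "path t - y"] \<open>\<rho> < B + \<epsilon>\<close> \<epsilon>(2) by simp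
    qed
    then show ?thesis using \<open>F \<noteq> bot\<close> by simp
  qed
  obtain z where z: "z \<in> K" "T z = z"
  proof (rule nonexpansive_fixed_point[OF us, of K T])
    show "closed K"
    proof (rule closure_subset_eq[THEN iffD1], rule subsetI)
      fix y assume y: "y \<in> closure K"
      have "K \<subseteq> D" by (auto simp: K_def)
      then have "y \<in> D" using y closure_minimal[OF _ D(1)] by blast
      moreover have "\<forall>\<^sub>F t in F. norm (path t - y) \<le> \<rho> + e" if "e > 0" for e
      proof -
        obtain k where k: "k \<in> K" "dist k y < e / 2"
          using y half_gt_zero[OF \<open>e > 0\<close>] unfolding closure_approachable by blast
        then have "\<forall>\<^sub>F t in F. norm (path t - k) \<le> \<rho> + e / 2" using that by (simp add: K_def)
        then show ?thesis
        proof eventually_elim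
          case (elim t)
          then show ?case
            using norm_triangle_ineq[of "path t - k" "k - y"] k(2) by (simp add: dist_norm)
        qed
      qed
      ultimately show "y \<in> K" by (simp add: K_def)
    qed
  next
    show "convex K"
    proof (rule convexI)
      fix y y' and u v :: real
      assume y: "y \<in> K" "y' \<in> K" and uv: "0 \<le> u" "0 \<le> v" "u + v = 1"
      have "\<forall>\<^sub>F t in F. norm (path t - (u *\<^sub>R y + v *\<^sub>R y')) \<le> \<rho> + e" if "e > 0" for e
      proof -
        have "\<forall>\<^sub>F t in F. norm (path t - y) \<le> \<rho> + e" "\<forall>\<^sub>F t in F. norm (path t - y') \<le> \<rho> + e"
          using y that by (auto simp: K_def)
        then show ?thesis
        proof eventually_elim
          case (elim t)
          have "path t - (u *\<^sub>R y + v *\<^sub>R y') = (u + v) *\<^sub>R path t - (u *\<^sub>R y + v *\<^sub>R y')"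
            using uv by simp
          also have "\<dots> = u *\<^sub>R (path t - y) + v *\<^sub>R (path t - y')" by (simp add: algebra_simps)
          also have "norm \<dots> \<le> u * (\<rho> + e) + v * (\<rho> + e)"
            using uv elim by (intro norm_combination_le)
          also have "\<dots> = \<rho> + e" using uv by (simp flip: distrib_right)
          finally show ?case .
        qed
      qed
      then show "u *\<^sub>R y + v *\<^sub>R y' \<in> K" using y uv D(2) by (auto simp: K_def convexD)
    qed
    show "bounded K"
      unfolding bounded_def using K_p by (metis dist_commute dist_norm)
    have "\<exists>y\<in>D. \<forall>\<^sub>F t in F. norm (path t - y) \<le> \<rho>" using \<rho>(1) by (simp add: A_def)
    then obtain y where "y \<in> D" and y: "\<forall>\<^sub>F t in F. norm (path t - y) \<le> \<rho>" by blast
    moreover have "\<forall>\<^sub>F t in F. norm (path t - y) \<le> \<rho> + e" if "e > 0" for e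
      using y by eventually_elim (use that in simp)
    ultimately show "K \<noteq> {}" by (auto simp: K_def)
    show "T ` K \<subseteq> K"
    proof clarify
      fix y assume y: "y \<in> K"
      have "\<forall>\<^sub>F t in F. norm (path t - T y) \<le> \<rho> + e" if "e > 0" for e
      proof -
        have "\<forall>\<^sub>F t in F. norm (path t - y) \<le> \<rho> + e / 2" using y that by (simp add: K_def)
        then show ?thesis
          using T_small[OF half_gt_zero[OF that]] t01
        proof eventually_elim
          case (elim t)
          have "norm (T (path t) - T y) \<le> norm (path t - y)"
            using y elim path_in by (intro T_nonexp) (auto simp: K_def)
          then show ?case
            using norm_triangle_ineq4[of "T (path t) - T y" "T (path t) - path t"] elim by simp
        qed
      qed
      then show "T y \<in> K" using y T_in by (simp add: K_def)
    qed
    show "norm (T x - T y) \<le> norm (x - y)" if "x \<in> K" "y \<in> K" for x y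
      using that by (intro T_nonexp) (auto simp: K_def)
  qed
  have zD: "z \<in> D" and zF: "z \<in> fixpoints D T" using z by (auto simp: K_def fixpoints_def)
  define w where "w = f z - z"
  have "norm (f z - f p) \<le> norm (z - p)" using zD fixD[OF p] by (intro f_nonexp)
  moreover have "norm w \<le> norm (f z - f p) + norm (f p - p) + norm (z - p)"
    using norm_add_diff_le[of "f z - f p" "f p - p" "z - p"] by (simp add: w_def)
  ultimately have wM: "norm w \<le> M" using K_p[OF z(1)] by (simp add: M_def)
  define \<sigma> where "\<sigma> = \<rho> + \<epsilon> - h * ((1 - L) * r) / 2"
  have "\<forall>\<^sub>F t in F. norm (path t - z) \<le> \<rho> + \<epsilon>" using z \<epsilon> by (simp add: K_def)
  then have "\<forall>\<^sub>F t in F. norm (path t - (z + h *\<^sub>R w)) \<le> \<sigma>"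
    using far t01
  proof eventually_elim
    case (elim t)
    have "norm (path t - z - t *\<^sub>R w) \<le> (1 - (1 - L) * t) * norm (path t - z) + t * 0"
      unfolding w_def using elim zF by (simp add: path_step_fixpoint)
    then have "norm (path t - z - h *\<^sub>R w)
        \<le> (1 - (1 - L) * h) * norm (path t - z) + h * (0 + (1 - L) * r / 2)"
      using elim zF wM by (intro descent) auto
    moreover have "h * ((1 - L) * r) \<le> h * ((1 - L) * norm (path t - z))"
      using elim zF h L by (intro mult_left_mono) auto
    ultimately have "norm (path t - z - h *\<^sub>R w) \<le> norm (path t - z) - h * ((1 - L) * r) / 2"
      by (simp add: field_simps)
    then show ?case using elim by (simp add: \<sigma>_def diff_diff_add)
  qed
  moreover have "z + h *\<^sub>R w \<in> D"
  proof -
    have "z + h *\<^sub>R w = (1 - h) *\<^sub>R z + h *\<^sub>R f z" by (simp add: w_def algebra_simps)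
    then show ?thesis using convexD[OF D(2) zD f_in[OF zD], of "1 - h" h] h by simp
  qed
  ultimately have "\<sigma> \<in> A" by (auto simp: A_def)
  then have "Inf A \<le> \<sigma>" using bdd by (rule cInf_lower)
  then show False using \<rho>(2) \<epsilon> by (simp add: \<sigma>_def)
qed

text \<open>This is the uniqueness argument for the variational inequality. Testing the path near
  \<open>z\<close> against \<open>z'\<close>, and the path near \<open>z'\<close> against
  \<open>z\<close>, gives two inequalities whose sum bounds \<open>(1 - L) * norm (z - z')\<close>
  by the errors, as \<open>f\<close> contracts.\<close>

lemma fixpoints_near_path_close:
  assumes r: "0 < r"
  obtains r' where "0 < r'"
    "\<And>t s z z'. 0 < t \<Longrightarrow> t < 1 \<Longrightarrow> 0 < s \<Longrightarrow> s < 1 \<Longrightarrow> z \<in> fixpoints D T \<Longrightarrow> z' \<in> fixpoints D T \<Longrightarrow>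
       norm (path t - z) < r' \<Longrightarrow> norm (path s - z') < r' \<Longrightarrow> norm (z - z') < r"
proof -
  obtain p where p: "p \<in> fixpoints D T" using fix_nonempty by auto
  define B where "B = norm (f p - p) / (1 - L)"
  have B: "0 \<le> B" using L by (simp add: B_def)
  define M where "M = 2 * B + norm (f p - p) + 1"
  have M: "0 < M" unfolding M_def using B(1) norm_ge_zero[of "f p - p"] by linarith
  obtain h where h: "0 < h" "h < 1"
    and descent: "\<And>(a::'a) w t c e. r / 2 \<le> norm a \<Longrightarrow> norm w \<le> M \<Longrightarrow> 0 < t \<Longrightarrow>
       norm (a - t *\<^sub>R w) \<le> (1 - c * t) * norm a + t * e \<Longrightarrow>
       norm (a - h *\<^sub>R w) \<le> (1 - c * h) * norm a + h * (e + (1 - L) * r / 4)"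
    using descent_at_fixed_scale[OF us half_gt_zero[OF r] M, of "(1 - L) * r / 4"] L r by auto
  \<comment> \<open>The final inequality bounds \<open>h * ((1 - L) * r)\<close> by half of itself
    plus \<open>6 * r'\<close>, and \<open>1/2 + 6/16 < 1\<close>.\<close>
  define r' where "r' = min (min 1 (r / 2)) (h * ((1 - L) * r) / 16)"
  have r': "0 < r'" "r' \<le> 1" "r' \<le> r / 2" "r' \<le> h * ((1 - L) * r) / 16"
    using h L r by (auto simp: r'_def)
  \<comment> \<open>Each of the three \<open>r'\<close> pays for one replacement of
    \<open>path t\<close> by \<open>z\<close>: in the norm on the right, in the base point, and
    under \<open>f\<close>.\<close>
  have half: "norm (z - z' - h *\<^sub>R (f z - z')) \<le> (1 - h) * norm (z - z') + h * ((1 - L) * r / 4) + 3 * r'"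
    if t: "0 < t" "t < 1" and s: "0 < s" "s < 1" and z: "z \<in> fixpoints D T" "z' \<in> fixpoints D T"
      and near: "norm (path t - z) < r'" "norm (path s - z') < r'" and zz: "r \<le> norm (z - z')"
    for t s z z'
  proof -
    let ?x = "path t"
    have x: "?x \<in> D" by (rule path_in[OF t])
    have "norm (f ?x - f p) \<le> norm (?x - p)" using x fixD[OF p] by (intro f_nonexp)
    moreover have "norm (?x - p) \<le> B" "norm (path s - p) \<le> B"
      unfolding B_def by (intro path_bounded t s p)+
    moreover have "norm (f ?x - z') \<le> norm (f ?x - f p) + norm (f p - p) + norm (z' - p)"
      using norm_add_diff_le[of "f ?x - f p" "f p - p" "z' - p"] by simp
    moreover have "norm (z' - p) \<le> norm (path s - p) + norm (path s - z')"
      using norm_triangle_ineq4[of "path s - p" "path s - z'"] by simp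
    ultimately have wM: "norm (f ?x - z') \<le> M" using near r' by (simp add: M_def)
    have far: "r / 2 \<le> norm (?x - z')"
      using norm_triangle_ineq4[of "?x - z'" "?x - z"] zz near r' by simp
    have "norm (?x - z' - t *\<^sub>R (f ?x - z')) \<le> (1 - 1 * t) * norm (?x - z') + t * 0"
      using path_step[OF t fixD(1)[OF z(2)]] fixD(2)[OF z(2)] by simp
    then have 1: "norm (?x - z' - h *\<^sub>R (f ?x - z')) \<le> (1 - 1 * h) * norm (?x - z') + h * (0 + (1 - L) * r / 4)"
      using far wM t by (intro descent) auto
    have 2: "(1 - h) * norm (?x - z') \<le> (1 - h) * norm (z - z') + r'"
    proof -
      have "norm (?x - z') \<le> norm (z - z') + r'"
        using norm_triangle_ineq[of "?x - z" "z - z'"] near by simp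
      then have "(1 - h) * norm (?x - z') \<le> (1 - h) * (norm (z - z') + r')"
        using h by (intro mult_left_mono) auto
      also have "\<dots> \<le> (1 - h) * norm (z - z') + 1 * r'"
        unfolding distrib_left using h r' by (intro add_left_mono mult_right_mono) auto
      finally show ?thesis by simp
    qed
    have "norm (f ?x - f z) \<le> r'"
      using f_nonexp[OF x fixD(1)[OF z(1)]] near by simp
    then have 3: "norm (1 *\<^sub>R (z - ?x) + h *\<^sub>R (f ?x - f z)) \<le> 1 * r' + h * r'"
      using near h by (intro norm_combination_le) (auto simp: norm_minus_commute)
    have "h * r' \<le> r'" using h r' by simp
    moreover have "z - z' - h *\<^sub>R (f z - z') =
        (?x - z' - h *\<^sub>R (f ?x - z')) + (1 *\<^sub>R (z - ?x) + h *\<^sub>R (f ?x - f z))"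
      by (simp add: algebra_simps)
    then have "norm (z - z' - h *\<^sub>R (f z - z')) \<le>
        norm (?x - z' - h *\<^sub>R (f ?x - z')) + norm (1 *\<^sub>R (z - ?x) + h *\<^sub>R (f ?x - f z))"
      by (metis norm_triangle_ineq)
    ultimately show ?thesis using 1 2 3 by simp
  qed
  show thesis
  proof
    fix t s z z'
    assume t: "0 < t" "t < 1" and s: "0 < s" "s < 1" and z: "z \<in> fixpoints D T" "z' \<in> fixpoints D T"
      and near: "norm (path t - z) < r'" "norm (path s - z') < r'"
    show "norm (z - z') < r"
    proof (rule ccontr)
      assume "\<not> ?thesis"
      then have zz: "r \<le> norm (z - z')" by simp
      let ?d = "z - z'"
      let ?P = "?d - h *\<^sub>R (f z - z')" and ?Q = "z' - z - h *\<^sub>R (f z' - z)"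
      have P: "norm ?P \<le> (1 - h) * norm ?d + h * ((1 - L) * r / 4) + 3 * r'"
        by (rule half) (use t s z near zz in auto)
      have Q: "norm ?Q \<le> (1 - h) * norm ?d + h * ((1 - L) * r / 4) + 3 * r'"
        using half[OF s t z(2) z(1) near(2) near(1)] zz by (simp add: norm_minus_commute)
      \<comment> \<open>The factor \<open>2 - h\<close> on the left against
        \<open>2 * (1 - h) + h * L\<close> on the right leaves \<open>h * (1 - L)\<close>.\<close>
      have "(2 - h) *\<^sub>R ?d = ?P + h *\<^sub>R (f z - f z') - ?Q" by (simp add: algebra_simps scaleR_2)
      then have "norm ((2 - h) *\<^sub>R ?d) \<le> norm ?P + norm (h *\<^sub>R (f z - f z')) + norm ?Q"
        by (metis norm_add_diff_le)
      moreover have "norm ((2 - h) *\<^sub>R ?d) = (2 - h) * norm ?d" using h by simp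
      moreover have "norm (h *\<^sub>R (f z - f z')) \<le> h * (L * norm ?d)"
        using f(2)[OF fixD(1)[OF z(1)] fixD(1)[OF z(2)]] h by simp
      ultimately have "h * ((1 - L) * norm ?d) \<le> h * ((1 - L) * r) / 2 + 6 * r'"
        using P Q by (simp add: algebra_simps)
      moreover have "h * ((1 - L) * r) \<le> h * ((1 - L) * norm ?d)"
        using zz h L by (intro mult_left_mono) auto
      moreover have "0 < h * ((1 - L) * r)" using h L r by simp
      ultimately show False using r'(4) by linarith
    qed
  qed (use r' in auto)
qed

lemma path_convergent: "\<exists>p\<in>fixpoints D T. (path \<longlongrightarrow> p) (at_right 0)"
proof -
  have "cauchy_filter (filtermap path (at_right 0))"
    unfolding cauchy_filter_metric_filtermap
  proof (intro allI impI)
    fix e :: real assume e: "e > 0"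
    obtain r where r: "0 < r"
      and close: "\<And>t s z z'. 0 < t \<Longrightarrow> t < 1 \<Longrightarrow> 0 < s \<Longrightarrow> s < 1 \<Longrightarrow> z \<in> fixpoints D T \<Longrightarrow> z' \<in> fixpoints D T \<Longrightarrow>
       norm (path t - z) < r \<Longrightarrow> norm (path s - z') < r \<Longrightarrow> norm (z - z') < e / 3"
      using fixpoints_near_path_close[of "e / 3"] e by (metis divide_pos_pos zero_less_numeral)
    define P where "P t \<longleftrightarrow> 0 < t \<and> t < 1 \<and> (\<exists>z\<in>fixpoints D T. norm (path t - z) < min r (e / 3))" for t
    have "\<forall>\<^sub>F t in at_right 0. 0 < t \<and> t < (1::real)" by (rule eventually_at_rightI[of 0 1]) auto
    moreover have "\<forall>\<^sub>F t in at_right 0. \<exists>z\<in>fixpoints D T. norm (path t - z) < min r (e / 3)"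
      using r e by (intro path_near_fixpoints) auto
    ultimately have "eventually P (at_right 0)" unfolding P_def by eventually_elim auto
    moreover have "dist (path t) (path s) < e" if P: "P t" "P s" for t s
    proof -
      obtain z where z: "z \<in> fixpoints D T" "norm (path t - z) < r" "norm (path t - z) < e / 3"
        using P by (auto simp: P_def)
      obtain z' where z': "z' \<in> fixpoints D T" "norm (path s - z') < r" "norm (path s - z') < e / 3"
        using P by (auto simp: P_def)
      have "norm (z - z') < e / 3" using P z z' by (intro close[of t s]) (auto simp: P_def)
      moreover have "norm (path t - path s) \<le> norm (path t - z) + norm (z - z') + norm (path s - z')"
        using norm_add_diff_le[of "path t - z" "z - z'" "path s - z'"] by simp
      ultimately show ?thesis using z z' by (simp add: dist_norm)
    qed
    ultimately show "\<exists>P. eventually P (at_right 0) \<and> (\<forall>x y. P x \<and> P y \<longrightarrow> dist (path x) (path y) < e)"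
      by blast
  qed
  then have "\<exists>p. filtermap path (at_right 0) \<le> nhds p"
    using cauchy_filter_complete_converges[OF _ complete_UNIV, of "filtermap path (at_right 0)"]
    by (simp add: filtermap_bot_iff)
  then obtain p where p: "(path \<longlongrightarrow> p) (at_right 0)" by (auto simp: filterlim_def)
  have in_D: "\<forall>\<^sub>F t in at_right 0. path t \<in> D"
    by (rule eventually_at_rightI[of 0 1]) (auto intro: path_in)
  have pD: "p \<in> D" using Lim_in_closed_set[OF D(1) in_D _ p] by simp
  have "((\<lambda>t. norm (path t - p)) \<longlongrightarrow> 0) (at_right 0)"
    using p by (simp add: LIM_zero_iff tendsto_norm_zero_iff)
  then have lim: "((\<lambda>t. 2 * norm (path t - p) + norm (T (path t) - path t)) \<longlongrightarrow> 2 * 0 + 0) (at_right 0)"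
    by (intro tendsto_intros path_asymptotically_fixed)
  have "\<forall>\<^sub>F t in at_right 0. norm (T p - p) \<le> 2 * norm (path t - p) + norm (T (path t) - path t)"
    using in_D
  proof eventually_elim
    case (elim t)
    have "norm (T p - p) \<le> norm (path t - p) + norm (T (path t) - path t) + norm (T (path t) - T p)"
      using norm_add_diff_le[of "path t - p" "T (path t) - path t" "T (path t) - T p"] by simp
    then show ?case using T_nonexp[OF elim pD] by simp
  qed
  then have "norm (T p - p) \<le> 2 * 0 + 0"
    by (intro tendsto_lowerbound[OF lim]) auto
  then show ?thesis using p pD by (auto simp: fixpoints_def)
qed

section \<open>Asymptotically fixed sequences compared with the path\<close>

text \<open>In the language of the duality map this says
  \<open>limsup \<langle>f p - p, J (x n - p)\<rangle> \<le> 0\<close>.\<close>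
lemma asymptotic_descent:
  assumes x: "\<And>n. x n \<in> D" "\<And>n. norm (x n - p) \<le> R"
    and fixed: "(\<lambda>n. norm (T (x n) - x n)) \<longlonglongrightarrow> 0"
    and p: "p \<in> fixpoints D T" "(path \<longlongrightarrow> p) (at_right 0)"
    and pos: "0 < r" "0 < \<eta>"
  obtains h where "0 < h" "h < 1"
    "\<forall>\<^sub>F n in sequentially. r \<le> norm (x n - p) \<longrightarrow>
       norm ((1 - h) *\<^sub>R (x n - p) + h *\<^sub>R (f p - p)) \<le> (1 - h) * norm (x n - p) + h * \<eta>"
proof -
  have pD: "p \<in> D" using fixD[OF p(1)] by simp
  define M where "M = 1 + norm (f p - p) + R"
  have "0 \<le> R" by (rule order_trans[OF norm_ge_zero x(2)])
  then have M: "0 < M" unfolding M_def using norm_ge_zero[of "f p - p"] by linarith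
  obtain h where h: "0 < h" "h < 1"
    and descent: "\<And>(a::'a) w t c e. r / 2 \<le> norm a \<Longrightarrow> norm w \<le> M \<Longrightarrow> 0 < t \<Longrightarrow>
       norm (a - t *\<^sub>R w) \<le> (1 - c * t) * norm a + t * e \<Longrightarrow>
       norm (a - h *\<^sub>R w) \<le> (1 - c * h) * norm a + h * (e + \<eta> / 4)"
    using descent_at_fixed_scale[OF us half_gt_zero[OF pos(1)] M, of "\<eta> / 4"] pos by auto
  \<comment> \<open>Replacing \<open>path t\<close> by \<open>p\<close> costs
    \<open>3 * \<tau>\<close>, at most half of \<open>h * \<eta>\<close>; the defect and the
    smoothness error, \<open>\<eta> / 4\<close> each, use the other half.\<close>
  define \<tau> where "\<tau> = min (min 1 (r / 2)) (h * \<eta> / 6)"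
  have \<tau>: "0 < \<tau>" "\<tau> \<le> 1" "\<tau> \<le> r / 2" "6 * \<tau> \<le> h * \<eta>" using h pos by (auto simp: \<tau>_def)
  have "\<forall>\<^sub>F t in at_right 0. norm (path t - p) < \<tau>"
    using tendstoD[OF p(2) \<tau>(1)] by (simp add: dist_norm)
  moreover have "\<forall>\<^sub>F t in at_right 0. 0 < t \<and> t < (1::real)" by (rule eventually_at_rightI[of 0 1]) auto
  ultimately have "\<forall>\<^sub>F t in at_right 0. norm (path t - p) < \<tau> \<and> 0 < t \<and> t < 1"
    by eventually_elim auto
  \<comment> \<open>One parameter is frozen before \<open>n\<close> varies, so the defect of
    \<open>x n\<close> divided by \<open>t\<close> still tends to 0.\<close>
  then obtain t where t: "0 < t" "t < 1" and near: "norm (path t - p) < \<tau>"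
    using eventually_happens'[OF trivial_limit_at_right_real] by blast
  let ?z = "path t"
  have z: "?z \<in> D" by (rule path_in[OF t])
  have fz: "norm (f ?z - f p) \<le> \<tau>" using f_nonexp[OF z pD] near by simp
  have "\<forall>\<^sub>F n in sequentially. norm (T (x n) - x n) < t * \<eta> / 4"
    using order_tendstoD(2)[OF fixed, of "t * \<eta> / 4"] t pos by simp
  then have "\<forall>\<^sub>F n in sequentially. r \<le> norm (x n - p) \<longrightarrow>
       norm ((1 - h) *\<^sub>R (x n - p) + h *\<^sub>R (f p - p)) \<le> (1 - h) * norm (x n - p) + h * \<eta>"
  proof eventually_elim
    case (elim n)
    let ?y = "x n"
    define e where "e = norm (T ?y - ?y) / t"
    have e: "e \<le> \<eta> / 4" using elim t by (simp add: e_def pos_divide_le_eq mult.commute)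
    show ?case
    proof
      assume far: "r \<le> norm (?y - p)"
      have zy: "r / 2 \<le> norm (?z - ?y)"
        using norm_triangle_ineq4[of "?z - p" "?z - ?y"] far near \<tau> by simp
      have "norm (f ?z - ?y) \<le> M"
        using norm_add_diff_le[of "f ?z - f p" "f p - p" "?y - p"] fz \<tau> x(2)[of n] by (simp add: M_def)
      then have "norm (?z - ?y - h *\<^sub>R (f ?z - ?y)) \<le> (1 - 1 * h) * norm (?z - ?y) + h * (e + \<eta> / 4)"
        using path_step[OF t x(1)[of n]] zy t by (intro descent) (auto simp: e_def)
      also have "\<dots> \<le> (1 - h) * (norm (?y - p) + \<tau>) + h * (\<eta> / 2)"
        using e h near norm_triangle_ineq4[of "?z - p" "?y - p"]
        by (intro add_mono mult_left_mono) auto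
      also have "\<dots> \<le> (1 - h) * norm (?y - p) + \<tau> + h * (\<eta> / 2)"
        unfolding distrib_left using h \<tau> by simp
      finally have 1: "norm (?y - ?z - h *\<^sub>R (?y - f ?z)) \<le> (1 - h) * norm (?y - p) + \<tau> + h * (\<eta> / 2)"
        using norm_minus_cancel[of "?z - ?y - h *\<^sub>R (f ?z - ?y)"] by (simp add: algebra_simps)
      have 2: "norm (h *\<^sub>R (f ?z - f p)) \<le> \<tau>"
        using mult_mono[of h 1 "norm (f ?z - f p)" \<tau>] fz h \<tau> by simp
      have "(1 - h) *\<^sub>R (?y - p) + h *\<^sub>R (f p - p) =
          (?z - p) + (?y - ?z - h *\<^sub>R (?y - f ?z)) - h *\<^sub>R (f ?z - f p)"
        by (simp add: algebra_simps)
      then have "norm ((1 - h) *\<^sub>R (?y - p) + h *\<^sub>R (f p - p)) \<le>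
          norm (?z - p) + norm (?y - ?z - h *\<^sub>R (?y - f ?z)) + norm (h *\<^sub>R (f ?z - f p))"
        by (metis norm_add_diff_le)
      then show "norm ((1 - h) *\<^sub>R (?y - p) + h *\<^sub>R (f p - p)) \<le> (1 - h) * norm (?y - p) + h * \<eta>"
        using 1 2 near \<tau>(4) by simp
    qed
  qed
  with h show thesis by (rule that)
qed

end

section \<open>Convergence of the iteration\<close>

text \<open>The error is half of the contraction available at level \<open>r\<close>. So a value at
  most \<open>r\<close> is never left upwards, and a sequence staying above \<open>r\<close> would
  lose at least \<open>s n * (c * r / 2)\<close> per step; telescoping would then make
  \<open>s\<close> summable.\<close>

lemma eventually_le_of_contractive_recursion:
  fixes b s :: "nat \<Rightarrow> real"
  assumes b: "\<And>n. 0 \<le> b n" and s: "\<And>n. 0 \<le> s n" "\<And>n. s n \<le> 1" "\<not> summable s"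
    and c: "0 < c" "c < 1" and r: "0 < r"
    and rec: "\<forall>\<^sub>F n in sequentially. r \<le> b (Suc n) \<longrightarrow> b (Suc n) \<le> (1 - c * s n) * b n + s n * (c * r / 2)"
  shows "\<forall>\<^sub>F n in sequentially. b n \<le> r"
proof -
  obtain N where N: "\<And>n. N \<le> n \<Longrightarrow> r \<le> b (Suc n) \<Longrightarrow> b (Suc n) \<le> (1 - c * s n) * b n + s n * (c * r / 2)"
    using rec by (auto simp: eventually_sequentially)
  show ?thesis
  proof (cases "\<exists>m\<ge>N. b m \<le> r")
    case True
    then obtain m where m: "N \<le> m" "b m \<le> r" by blast
    have "b n \<le> r" if "m \<le> n" for n
      using that
    proof (induction n rule: dec_induct)
      case (step n)
      show ?case
      proof (rule ccontr)
        assume "\<not> ?thesis"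
        then have "b (Suc n) \<le> (1 - c * s n) * b n + s n * (c * r / 2)" using N[of n] m step by simp
        also have "\<dots> \<le> (1 - c * s n) * r + s n * (c * r / 2)"
          using step s(1,2)[of n] c mult_mono[of c 1 "s n" 1] by (intro add_right_mono mult_left_mono) auto
        also have "\<dots> = r - s n * (c * r / 2)" by (simp add: algebra_simps)
        also have "\<dots> \<le> r" using s c r by simp
        finally show False using \<open>\<not> b (Suc n) \<le> r\<close> by simp
      qed
    qed (use m in simp)
    then show ?thesis unfolding eventually_sequentially by blast
  next
    case False
    then have big: "r < b n" if "N \<le> n" for n using that by force
    define d where "d = c * r / 2"
    have d: "0 < d" using c r by (simp add: d_def)
    have step: "d * s n \<le> b n - b (Suc n)" if n: "N \<le> n" for n
    proof -
      have "b (Suc n) \<le> (1 - c * s n) * b n + s n * (c * r / 2)"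
        using N[OF n] big[of "Suc n"] n by simp
      moreover have "c * s n * r \<le> c * s n * b n"
        using big[OF n] s c by (intro mult_left_mono) auto
      ultimately show ?thesis by (simp add: algebra_simps d_def)
    qed
    have "d * (\<Sum>i<k. s (i + N)) \<le> b N - b (k + N)" for k
    proof (induction k)
      case (Suc k)
      then show ?case using step[of "k + N"] by (simp add: distrib_left)
    qed simp
    then have "d * (\<Sum>i<k. s (i + N)) \<le> b N" for k by (rule order_trans) (use b in simp)
    then have "(\<Sum>i<k. s (i + N)) \<le> b N / d" for k
      using d by (simp only: pos_le_divide_eq mult.commute[of _ d])
    then have "summable (\<lambda>i. s (i + N))" using s by (intro summableI_nonneg_bounded)
    then have "summable s" by (simp add: summable_iff_shift)
    with s show ?thesis by blast
  qed
qed

theorem (in viscosity) viscosity_iteration_converges: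
  assumes x0: "x 0 \<in> D" and s: "\<And>n. 0 \<le> s n \<and> s n \<le> 1" "\<not> summable s"
    and x_Suc: "\<And>n. x (Suc n) = s n *\<^sub>R f (x n) + (1 - s n) *\<^sub>R T (x n)"
    and fixed: "(\<lambda>n. norm (T (x n) - x n)) \<longlonglongrightarrow> 0"
  shows "x \<longlonglongrightarrow> Qmap D T f"
proof -
  obtain p where p: "p \<in> fixpoints D T" "(path \<longlongrightarrow> p) (at_right 0)"
    using path_convergent by blast
  have Q: "Qmap D T f = p" unfolding Qmap_def using p(2) by (intro tendsto_Lim) auto
  have pD: "p \<in> D" "T p = p" using fixD[OF p(1)] by auto
  have xD: "x n \<in> D" for n
  proof (induction n)
    case (Suc n)
    then show ?case unfolding x_Suc using s(1)[of n] f_in T_in by (intro convexD[OF D(2)]) auto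
  qed (use x0 in simp)
  define w where "w = f p - p"
  have step: "norm (x (Suc n) - p - s n *\<^sub>R w) \<le> (1 - (1 - L) * s n) * norm (x n - p)" for n
  proof -
    have "x (Suc n) - p - s n *\<^sub>R w = s n *\<^sub>R (f (x n) - f p) + (1 - s n) *\<^sub>R (T (x n) - T p)"
      using pD by (simp add: x_Suc w_def algebra_simps)
    also have "norm \<dots> \<le> s n * (L * norm (x n - p)) + (1 - s n) * norm (x n - p)"
      using s(1)[of n] xD pD by (intro norm_combination_le f T_nonexp) auto
    finally show ?thesis by (simp add: algebra_simps)
  qed
  \<comment> \<open>The second entry ensures \<open>norm w <= (1 - L) * R\<close>, so the bound
    \<open>R\<close> reproduces itself under \<open>step\<close>.\<close>
  define R where "R = max (norm (x 0 - p)) (norm w / (1 - L))"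
  have "norm w / (1 - L) \<le> R" by (simp add: R_def)
  then have wR: "norm w \<le> (1 - L) * R" using L by (simp add: pos_divide_le_eq mult.commute)
  have s01: "0 \<le> 1 - (1 - L) * s n" for n
    using mult_mono[of "1 - L" 1 "s n" 1] L s(1)[of n] by simp
  have R: "norm (x n - p) \<le> R" for n
  proof (induction n)
    case (Suc n)
    have "norm (x (Suc n) - p) \<le> norm (x (Suc n) - p - s n *\<^sub>R w) + s n * norm w"
      using norm_triangle_ineq[of "x (Suc n) - p - s n *\<^sub>R w" "s n *\<^sub>R w"] s(1)[of n] by simp
    also have "\<dots> \<le> (1 - (1 - L) * s n) * R + s n * ((1 - L) * R)"
      using s(1)[of n] wR order_trans[OF step mult_left_mono[OF Suc s01]]
      by (intro add_mono mult_left_mono) auto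
    also have "\<dots> = R" by (simp add: algebra_simps)
    finally show ?case .
  qed (simp add: R_def)
  have "\<forall>\<^sub>F n in sequentially. norm (x n - p) \<le> r" if r: "0 < r" for r
  proof (rule eventually_le_of_contractive_recursion[where s = s and c = "1 - L"])
    define \<eta> where "\<eta> = (1 - L) * r / 2"
    have "0 < \<eta>" using L r by (simp add: \<eta>_def)
    then obtain h where h: "0 < h" "h < 1" and ev: "\<forall>\<^sub>F n in sequentially. r \<le> norm (x n - p) \<longrightarrow>
       norm ((1 - h) *\<^sub>R (x n - p) + h *\<^sub>R w) \<le> (1 - h) * norm (x n - p) + h * \<eta>"
      using asymptotic_descent[of x p R r \<eta>] xD R fixed p r unfolding w_def by blast
    have "\<forall>\<^sub>F n in sequentially. r \<le> norm (x (Suc n) - p) \<longrightarrow>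
       norm ((1 - h) *\<^sub>R (x (Suc n) - p) + h *\<^sub>R w) \<le> (1 - h) * norm (x (Suc n) - p) + h * \<eta>"
      using ev by (subst eventually_sequentially_Suc)
    then show "\<forall>\<^sub>F n in sequentially. r \<le> norm (x (Suc n) - p) \<longrightarrow>
        norm (x (Suc n) - p) \<le> (1 - (1 - L) * s n) * norm (x n - p) + s n * ((1 - L) * r / 2)"
    proof eventually_elim
      case (elim n)
      show ?case
      proof
        let ?a = "x (Suc n) - p"
        assume "r \<le> norm ?a"
        then have *: "norm ((1 - h) *\<^sub>R ?a + h *\<^sub>R w) \<le> (1 - h) * norm ?a + h * \<eta>" using elim by blast
        \<comment> \<open>The weights \<open>h\<close> and \<open>s n\<close> cancel
          \<open>w\<close> between the recursion and the asymptotic descent at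
          \<open>x (Suc n)\<close>; the term \<open>s n * (1 - h) * norm ?a\<close> then occurs on
          both sides and drops out.\<close>
        have comb: "(h + s n * (1 - h)) *\<^sub>R ?a = h *\<^sub>R (?a - s n *\<^sub>R w) + s n *\<^sub>R ((1 - h) *\<^sub>R ?a + h *\<^sub>R w)"
          by (simp add: algebra_simps)
        have "norm (h *\<^sub>R (?a - s n *\<^sub>R w) + s n *\<^sub>R ((1 - h) *\<^sub>R ?a + h *\<^sub>R w)) \<le>
            h * ((1 - (1 - L) * s n) * norm (x n - p)) + s n * ((1 - h) * norm ?a + h * \<eta>)"
          using h s(1)[of n] by (intro norm_combination_le step *) auto
        moreover have "norm ((h + s n * (1 - h)) *\<^sub>R ?a) = (h + s n * (1 - h)) * norm ?a"
          using h s(1)[of n] by simp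
        ultimately have "(h + s n * (1 - h)) * norm ?a \<le>
            h * ((1 - (1 - L) * s n) * norm (x n - p)) + s n * ((1 - h) * norm ?a + h * \<eta>)"
          unfolding comb by linarith
        then have "h * norm ?a \<le> h * ((1 - (1 - L) * s n) * norm (x n - p) + s n * \<eta>)"
          by (simp add: algebra_simps)
        then show "norm ?a \<le> (1 - (1 - L) * s n) * norm (x n - p) + s n * ((1 - L) * r / 2)"
          using h by (simp add: \<eta>_def)
      qed
    qed
  qed (use s L r in auto)
  note eventually_le = this
  have "\<forall>\<^sub>F n in sequentially. dist (x n) p < e" if "0 < e" for e
    using eventually_le[OF half_gt_zero[OF that]] by eventually_elim (use that in \<open>simp add: dist_norm\<close>)
  then have "x \<longlonglongrightarrow> p" by (rule tendstoI)
  then show ?thesis by (simp add: Q)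
qed

theorem theorem3p1:
  fixes D :: "'a::banach set" and T f :: "'a \<Rightarrow> 'a" and x0 :: 'a
    and \<alpha> :: "nat \<Rightarrow> real" and x :: "nat \<Rightarrow> 'a"
  assumes "uniformly_smooth TYPE('a)"
    and "D \<noteq> {}" and "closed D" and "convex D"
    and "nonexpansive_on D T" and "fixpoints D T \<noteq> {}"
    and "f \<in> contractions D" and "x0 \<in> D"
    and "\<And>n. 0 \<le> \<alpha> n \<and> \<alpha> n \<le> 1"
    and "\<alpha> \<longlonglongrightarrow> 0" and "\<not> summable \<alpha>"
    and "x 0 = x0"
    and "\<And>n. x (Suc n) = \<alpha> n *\<^sub>R f (x n) + (1 - \<alpha> n) *\<^sub>R T (x n)"
    and "(\<lambda>n. norm (T (x n) - x n)) \<longlonglongrightarrow> 0"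
  shows "x \<longlonglongrightarrow> Qmap D T f"
proof -
  obtain L where "0 < L" "L < 1" "f ` D \<subseteq> D" "\<And>x y. x \<in> D \<Longrightarrow> y \<in> D \<Longrightarrow> norm (f x - f y) \<le> L * norm (x - y)"
    using assms(7) unfolding contractions_def by blast
  then interpret viscosity D T f L
    using assms by unfold_locales auto
  show ?thesis
    using viscosity_iteration_converges[of x \<alpha>] assms by simp
qed

end
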